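(* Let $\mathcal{C}$ be a unital $C^*$-algebra and let $\mathcal{D}\subseteq\mathcal{C}$ be an abelian $C^*$-subalgebra containing the unit of $\mathcal{C}$. For $v\in\mathcal{N}(\mathcal{C})$, if $\beta_{v^*}$ extends to a homeomorphism of $\overline{S(v^* )}$ onto $\overline{S(v)}$, then $v$ is an intertwiner, that is, $v\mathcal{D}=\mathcal{D}v$. Moreover, if $\mathcal{I}:=\{w\in\mathcal{C}: w\mathcal{D}=\mathcal{D}w\}$ is the set of intertwiners, then $\mathcal{N}(\mathcal{C})$ is contained in the norm-closure of $\mathcal{I}$, and when $\mathcal{D}$ is a MASA in $\mathcal{C}$, $\mathcal{N}(\mathcal{C})=\overline{\mathcal{I}}$.
   Context: $\mathcal{N}(\mathcal{C})=\{v\in\mathcal{C}: v\mathcal{D}v^*\cup v^*\mathcal{D}v\subseteq\mathcal{D}\}$ is the set of normalizers of $\mathcal{D}$ in $\mathcal{C}$. $\hat{\mathcal{D}}$ is the space of multiplicative linear functionals (characters) of $\mathcal{D}$ with the weak-$*$ topology. For $v\in\mathcal{N}(\mathcal{C})$, $S(v):=\{\phi\in\hat{\mathcal{D}}:\phi(v^*v)>0\}$, an open subset of $\hat{\mathcal{D}}$, and $\beta_v:S(v)\to S(v^* )$ is the homeomorphism given by $\beta_v(\phi)(d)=\phi(v^*dv)/\phi(v^*v)$, $d\in\mathcal{D}$; one has $\beta_v^{-1}=\beta_{v^*}$. Closures of subsets of $\hat{\mathcal{D}}$ are taken in $\hat{\mathcal{D}}$; the closure $\overline{\mathcal{I}}$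 is the norm closure. MASA means maximal abelian (self-adjoint) subalgebra. *)

theory Defs
  imports "HOL-Analysis.Analysis"
begin

section \<open>Unital C*-algebras and their subalgebras\<close>

text \<open>
  Completeness and submultiplicativity of the norm come from the library's real Banach algebra
  classes; \<open>scaleR_conv_scaleC\<close> makes the complex structure extend the real one.
  The class \<^class>\<open>real_normed_algebra_1\<close> contains \<open>0 \<noteq> 1\<close> and \<open>norm 1 = 1\<close>;
  the latter is automatic in a nonzero unital C*-algebra.
\<close>

class unital_cstar_algebra = real_normed_algebra_1 + banach +
  fixes scaleC :: "complex \<Rightarrow> 'a \<Rightarrow> 'a"  (infixr \<open>*\<^sub>C\<close> 75)
    and star :: "'a \<Rightarrow> 'a"  (\<open>_\<^sup>\<star>\<close> [1000] 999)
  assumes scaleR_conv_scaleC: "scaleR r x = complex_of_real r *\<^sub>C x"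
    and scaleC_add_right: "c *\<^sub>C (x + y) = c *\<^sub>C x + c *\<^sub>C y"
    and scaleC_add_left: "(b + c) *\<^sub>C x = b *\<^sub>C x + c *\<^sub>C x"
    and scaleC_scaleC: "b *\<^sub>C (c *\<^sub>C x) = (b * c) *\<^sub>C x"
    and mult_scaleC_left: "(c *\<^sub>C x) * y = c *\<^sub>C (x * y)"
    and mult_scaleC_right: "x * (c *\<^sub>C y) = c *\<^sub>C (x * y)"
    and norm_scaleC: "norm (c *\<^sub>C x) = cmod c * norm x"
    and star_add: "(x + y)\<^sup>\<star> = x\<^sup>\<star> + y\<^sup>\<star>"
    and star_scaleC: "(c *\<^sub>C x)\<^sup>\<star> = cnj c *\<^sub>C x\<^sup>\<star>"
    and star_mult: "(x * y)\<^sup>\<star> = y\<^sup>\<star> * x\<^sup>\<star>"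
    and star_star: "(x\<^sup>\<star>)\<^sup>\<star> = x"
    and cstar_identity: "norm (x\<^sup>\<star> * x) = (norm x)\<^sup>2"

definition star_subalgebra :: "'a::unital_cstar_algebra set \<Rightarrow> bool" where
  "star_subalgebra A \<longleftrightarrow>
     0 \<in> A \<and> (\<forall>x\<in>A. \<forall>y\<in>A. x + y \<in> A) \<and> (\<forall>c. \<forall>x\<in>A. c *\<^sub>C x \<in> A) \<and>
     (\<forall>x\<in>A. \<forall>y\<in>A. x * y \<in> A) \<and> (\<forall>x\<in>A. x\<^sup>\<star> \<in> A)"

definition cstar_subalgebra :: "'a::unital_cstar_algebra set \<Rightarrow> bool" where
  "cstar_subalgebra A \<longleftrightarrow> star_subalgebra A \<and> closed A"

definition abelian :: "'a::unital_cstar_algebra set \<Rightarrow> bool" where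
  "abelian A \<longleftrightarrow> (\<forall>x\<in>A. \<forall>y\<in>A. x * y = y * x)"

definition masa :: "'a::unital_cstar_algebra set \<Rightarrow> bool" where
  "masa D \<longleftrightarrow> star_subalgebra D \<and> abelian D \<and>
     (\<forall>A. star_subalgebra A \<and> abelian A \<and> D \<subseteq> A \<longrightarrow> A = D)"


section \<open>Normalizers and intertwiners\<close>

definition normalizers :: "'a::unital_cstar_algebra set \<Rightarrow> 'a set" where
  "normalizers D = {v. (\<lambda>d. v * d * v\<^sup>\<star>) ` D \<union> (\<lambda>d. v\<^sup>\<star> * d * v) ` D \<subseteq> D}"

definition intertwiners :: "'a::unital_cstar_algebra set \<Rightarrow> 'a set" where
  "intertwiners D = {w. (\<lambda>d. w * d) ` D = (\<lambda>d. d * w) ` D}"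


section \<open>The character space and the partial homeomorphisms\<close>

text \<open>
  A character of \<open>D\<close> is a nonzero multiplicative linear functional on \<open>D\<close>. It is represented
  by a function on the whole type that is \<^const>\<open>undefined\<close> off \<open>D\<close>, so that distinct
  representatives are distinct functionals on \<open>D\<close>.
\<close>

definition characters :: "'a::unital_cstar_algebra set \<Rightarrow> ('a \<Rightarrow> complex) set" where
  "characters D = {\<phi> \<in> extensional D.
     (\<forall>x\<in>D. \<forall>y\<in>D. \<phi> (x + y) = \<phi> x + \<phi> y) \<and>
     (\<forall>c. \<forall>x\<in>D. \<phi> (c *\<^sub>C x) = c * \<phi> x) \<and>
     (\<forall>x\<in>D. \<forall>y\<in>D. \<phi> (x * y) = \<phi> x * \<phi> y) \<and>
     (\<exists>x\<in>D. \<phi> x \<noteq> 0)}"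

text \<open>The weak-* topology is the topology of pointwise convergence on \<open>D\<close>.\<close>

definition character_space :: "'a::unital_cstar_algebra set \<Rightarrow> ('a \<Rightarrow> complex) topology" where
  "character_space D = subtopology (product_topology (\<lambda>_. euclidean) D) (characters D)"

text \<open>The condition on \<open>\<phi>\<close> below says that the complex number \<open>\<phi> (v\<^sup>\<star> * v)\<close> is real and
  strictly positive.\<close>

definition S_set :: "'a::unital_cstar_algebra set \<Rightarrow> 'a \<Rightarrow> ('a \<Rightarrow> complex) set" where
  "S_set D v = {\<phi> \<in> characters D. \<phi> (v\<^sup>\<star> * v) \<in> \<real> \<and> Re (\<phi> (v\<^sup>\<star> * v)) > 0}"

definition beta ::
    "'a::unital_cstar_algebra set \<Rightarrow> 'a \<Rightarrow> ('a \<Rightarrow> complex) \<Rightarrow> ('a \<Rightarrow> complex)" where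
  "beta D v \<phi> = (\<lambda>d\<in>D. \<phi> (v\<^sup>\<star> * d * v) / \<phi> (v\<^sup>\<star> * v))"

definition closure_S :: "'a::unital_cstar_algebra set \<Rightarrow> 'a \<Rightarrow> ('a \<Rightarrow> complex) topology" where
  "closure_S D v =
     subtopology (character_space D) (character_space D closure_of S_set D v)"

definition beta_extends :: "'a::unital_cstar_algebra set \<Rightarrow> 'a \<Rightarrow> bool" where
  "beta_extends D v \<longleftrightarrow>
     (\<exists>h. homeomorphic_map (closure_S D v) (closure_S D (v\<^sup>\<star>)) h \<and>
          (\<forall>\<phi>\<in>S_set D v. h \<phi> = beta D v \<phi>))"

end

theory Submission
  imports Defs
begin

text \<open>
  The idea is to read every relation between a normalizer \<open>v\<close> and \<open>D\<close> off the characters of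
  \<open>D\<close>. By Gelfand's theorem \<open>D\<close> is the algebra of continuous functions on its compact
  Hausdorff character space, so an element of \<open>D\<close> can be prescribed by its values on characters
  (\<open>gelfand_surj\<close>), identities in \<open>D\<close> can be checked there (\<open>characters_eqI\<close>), and norms
  are suprema (\<open>norm_le_of_characters\<close>).

  \<^bold>\<open>Extension implies intertwining.\<close> If \<open>h\<close> extends \<open>beta D (v\<^sup>\<star>)\<close> to the closures, then for
  \<open>d \<in> D\<close> the function \<open>\<phi> \<mapsto> h \<phi> d\<close> is continuous on a closed set, hence by Tietze's theorem it
  is the restriction of the Gelfand transform of some \<open>d' \<in> D\<close>. The definition of \<open>beta\<close> then
  says \<open>d' (v v\<^sup>\<star>) = v d v\<^sup>\<star>\<close>, first on \<open>S_set D (v\<^sup>\<star>)\<close> and, as both sides vanish elsewhere,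
  everywhere. This forces \<open>v d = d' v\<close> (\<open>intertwines_of_ratio\<close>). The inverse of \<open>h\<close> extends
  \<open>beta D v\<close>, and the same argument for \<open>v\<^sup>\<star>\<close> gives the other inclusion. One point needs care:
  \<open>S_set\<close> asks for \<open>\<phi> (v\<^sup>\<star> v) > 0\<close>, whereas the argument needs \<open>\<phi> (v\<^sup>\<star> v) \<noteq> 0\<close>; the two agree
  because \<open>v\<^sup>\<star> v\<close> is positive (\<open>normalizer_nonneg\<close>).

  \<^bold>\<open>Density.\<close> Put \<open>a = v\<^sup>\<star> v\<close> and cut \<open>v\<close> off near the kernel of \<open>a\<close>: let \<open>g\<close> be a function of
  \<open>a\<close> that vanishes where \<open>\<bar>a\<bar> \<le> e\<close>. Then \<open>a\<close> has an inverse \<open>k\<close> in \<open>D\<close> on the support of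
  \<open>g\<close>, and \<open>v g d = (v d k v\<^sup>\<star>) (v g)\<close> and \<open>d v g = (v g) (k v\<^sup>\<star> d v)\<close> exhibit \<open>v g\<close> as an
  intertwiner (\<open>truncation_intertwines\<close>), while \<open>v g\<close> tends to \<open>v\<close> as \<open>e\<close> tends to \<open>0\<close>.

  \<^bold>\<open>Maximal abelian subalgebras.\<close> The normalizers form a closed set, so it remains to see that an
  intertwiner \<open>w\<close> is a normalizer, for which it is enough that \<open>w d w\<^sup>\<star>\<close> and \<open>w\<^sup>\<star> d w\<close> commute
  with \<open>D\<close>. This follows by moving a self-adjoint \<open>e \<in> D\<close> across, once \<open>w e = c w\<close> is known to
  imply \<open>w e = c\<^sup>\<star> w\<close>. That is a Fuglede-Putnam type statement (\<open>intertwined_sa\<close>): it says that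
  \<open>w\<close> can only live over the real part of the spectrum of \<open>c\<close>.

  \<^bold>\<open>Gelfand theory.\<close> Characters are obtained from orderings, without spectra or
  quotient algebras. Let \<open>sa\<close> be the real algebra of self-adjoint elements of \<open>D\<close>. A maximal
  proper preordering orders \<open>sa\<close> totally, with the reals cofinal, so \<open>x \<mapsto> Sup {r. r \<le> x}\<close> is
  a ring homomorphism to the reals (\<open>order_character_is_character\<close>). If \<open>x\<close> is not positive,
  the preordering generated by the squares and \<open>- x\<close> is proper, and the resulting character is
  nonpositive at \<open>x\<close> (\<open>character_of_not_pos\<close>). So characters detect positivity, therefore the norm, and
  the Stone-Weierstrass theorem does the rest.
\<close>

section \<open>The involution and the complex structure\<close>

lemma star_zero [simp]: "(0::'a::unital_cstar_algebra)\<^sup>\<star> = 0"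
  using star_add[of 0 0] by simp

lemma star_minus [simp]: "(- x)\<^sup>\<star> = - (x\<^sup>\<star>)" for x :: "'a::unital_cstar_algebra"
  using star_add[of x "- x"] by (simp add: eq_neg_iff_add_eq_0 add.commute)

lemma star_diff: "(x - y)\<^sup>\<star> = x\<^sup>\<star> - y\<^sup>\<star>" for x y :: "'a::unital_cstar_algebra"
  using star_add[of x "- y"] by simp

lemma star_scaleR: "(r *\<^sub>R x)\<^sup>\<star> = r *\<^sub>R (x\<^sup>\<star>)" for x :: "'a::unital_cstar_algebra"
  by (simp add: scaleR_conv_scaleC star_scaleC)

lemma star_one [simp]: "(1::'a::unital_cstar_algebra)\<^sup>\<star> = 1"
  using star_mult[of "1\<^sup>\<star>" "1::'a"] by (simp add: star_star)

lemma star_of_real [simp]: "(of_real r :: 'a::unital_cstar_algebra)\<^sup>\<star> = of_real r"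
  by (simp add: of_real_def star_scaleR)

declare star_star [simp]

lemma norm_star [simp]: "norm (x\<^sup>\<star>) = norm x" for x :: "'a::unital_cstar_algebra"
proof -
  have "norm y \<le> norm (y\<^sup>\<star>)" for y :: 'a
  proof (cases "y = 0")
    case False
    have "(norm y)\<^sup>2 \<le> norm (y\<^sup>\<star>) * norm y"
      using norm_mult_ineq[of "y\<^sup>\<star>" y] by (simp add: cstar_identity)
    with False show ?thesis
      by (simp add: power2_eq_square)
  qed simp
  from this[of x] this[of "x\<^sup>\<star>"] show ?thesis by simp
qed

lemma star_mult_self_eq_0: "x\<^sup>\<star> * x = 0 \<Longrightarrow> x = 0" for x :: "'a::unital_cstar_algebra"
  using cstar_identity[of x] by simp

lemma tendsto_star [tendsto_intros]:
  "(f \<longlongrightarrow> l) F \<Longrightarrow> ((\<lambda>x. (f x :: 'a::unital_cstar_algebra)\<^sup>\<star>) \<longlongrightarrow> l\<^sup>\<star>) F"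
  by (simp add: tendsto_iff dist_norm star_diff[symmetric])

lemma continuous_on_star [continuous_intros]:
  "continuous_on S f \<Longrightarrow> continuous_on S (\<lambda>x. (f x :: 'a::unital_cstar_algebra)\<^sup>\<star>)"
  by (simp add: continuous_on_def tendsto_star)

lemma scaleC_one [simp]: "1 *\<^sub>C x = x" for x :: "'a::unital_cstar_algebra"
  using scaleR_conv_scaleC[of 1 x] by simp

lemma scaleC_minus_one: "(- 1) *\<^sub>C x = - x" for x :: "'a::unital_cstar_algebra"
  using scaleR_conv_scaleC[of "- 1" x] by simp

lemma scaleC_minus_left: "(- c) *\<^sub>C x = - (c *\<^sub>C x)" for x :: "'a::unital_cstar_algebra"
  using scaleC_scaleC[of "- 1" c x] by (simp add: scaleC_minus_one)

lemma scaleC_minus_right: "c *\<^sub>C (- x) = - (c *\<^sub>C x)" for x :: "'a::unital_cstar_algebra"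
  using scaleC_scaleC[of c "- 1" x] by (simp add: scaleC_minus_one scaleC_minus_left)

lemma scaleC_diff_right: "c *\<^sub>C (x - y) = c *\<^sub>C x - c *\<^sub>C y" for x :: "'a::unital_cstar_algebra"
  using scaleC_add_right[of c x "- y"] by (simp add: scaleC_minus_right)

lemma scaleC_diff_left: "(b - c) *\<^sub>C x = b *\<^sub>C x - c *\<^sub>C x" for x :: "'a::unital_cstar_algebra"
  using scaleC_add_left[of b "- c" x] by (simp add: scaleC_minus_left)

definition re_part :: "'a::unital_cstar_algebra \<Rightarrow> 'a" where
  "re_part x = (1/2) *\<^sub>R (x + x\<^sup>\<star>)"

definition im_part :: "'a::unital_cstar_algebra \<Rightarrow> 'a" where
  "im_part x = (- \<i> / 2) *\<^sub>C (x - x\<^sup>\<star>)"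

lemma star_re_part [simp]: "(re_part x)\<^sup>\<star> = re_part x"
  by (simp add: re_part_def star_scaleR star_add add.commute)

lemma star_im_part [simp]: "(im_part x)\<^sup>\<star> = im_part x"
proof -
  have "(im_part x)\<^sup>\<star> = (\<i> / 2) *\<^sub>C (- (x - x\<^sup>\<star>))"
    by (simp add: im_part_def star_scaleC star_diff)
  then show ?thesis
    by (simp only: scaleC_minus_right im_part_def scaleC_minus_left[symmetric]) simp
qed

lemma re_im_decomp: "x = re_part x + \<i> *\<^sub>C im_part x"
proof -
  have "\<i> *\<^sub>C im_part x = (1/2) *\<^sub>R (x - x\<^sup>\<star>)"
    by (simp add: im_part_def scaleC_scaleC scaleR_conv_scaleC)
  then show ?thesis
    by (simp add: re_part_def scaleR_add_right[symmetric] scaleR_2[symmetric])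
qed

lemma re_part_eq:
  assumes "h\<^sup>\<star> = h" "k\<^sup>\<star> = k"
  shows "re_part (h + \<i> *\<^sub>C k) = h"
  by (simp add: re_part_def star_add star_scaleC assms scaleC_minus_left scaleR_2[symmetric])

lemma im_part_eq:
  assumes "h\<^sup>\<star> = h" "k\<^sup>\<star> = k"
  shows "im_part (h + \<i> *\<^sub>C k) = k"
proof -
  have "(h + \<i> *\<^sub>C k) - (h + \<i> *\<^sub>C k)\<^sup>\<star> = 2 *\<^sub>R (\<i> *\<^sub>C k)"
    by (simp add: star_add star_scaleC assms scaleC_minus_left scaleR_2[symmetric])
  also have "\<dots> = (2 * \<i>) *\<^sub>C k"
    by (simp add: scaleC_scaleC scaleR_conv_scaleC)
  finally show ?thesis
    by (simp add: im_part_def scaleC_scaleC)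
qed

text \<open>
  The commutator \<open>p q - q p\<close> of the real and imaginary parts cancels. This identity shows that
  \<open>x\<^sup>\<star> x\<close> and \<open>x x\<^sup>\<star>\<close> cannot both be negative.
\<close>

lemma star_mult_self_plus:
  "x\<^sup>\<star> * x + x * x\<^sup>\<star> = 2 *\<^sub>R (re_part x * re_part x + im_part x * im_part x)"
  for x :: "'a::unital_cstar_algebra"
proof -
  define p q where pq: "p = re_part x" "q = im_part x"
  have x: "x = p + \<i> *\<^sub>C q" by (simp add: pq flip: re_im_decomp)
  have xs: "x\<^sup>\<star> = p - \<i> *\<^sub>C q" 
    unfolding x by (simp add: star_add star_scaleC scaleC_minus_left) (simp add: pq)
  have "x\<^sup>\<star> * x + x * x\<^sup>\<star> = 2 *\<^sub>R (p * p + q * q)"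
    unfolding xs unfolding x
    by (simp add: ring_distribs mult_scaleC_left mult_scaleC_right scaleC_scaleC scaleC_minus_one
        scaleC_diff_right scaleC_add_right scaleR_2)
  then show ?thesis by (simp add: pq)
qed

section \<open>Inverses and square roots near the unit\<close>

text \<open>
  The inverse is the fixed point of the contraction \<open>z \<mapsto> 1 + y z\<close>, which maps \<open>S\<close> to itself. The
  set \<open>S\<close> is a parameter so that the inverse stays in \<open>D\<close>, or among its self-adjoint elements.
\<close>

lemma one_minus_invertible_in:
  fixes S :: "'a::{real_normed_algebra_1,banach} set"
  assumes "closed S" "1 \<in> S" "\<And>x y. x \<in> S \<Longrightarrow> y \<in> S \<Longrightarrow> x + y \<in> S"
    "\<And>x y. x \<in> S \<Longrightarrow> y \<in> S \<Longrightarrow> x * y \<in> S" "y \<in> S" "norm y < 1"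
  obtains z where "z \<in> S" "(1 - y) * z = 1"
proof -
  have "\<exists>!z\<in>S. 1 + y * z = z"
  proof (rule Banach_fix)
    show "complete S" using assms(1) by (simp add: complete_eq_closed)
    show "S \<noteq> {}" using assms(2) by blast
    show "dist (1 + y * x) (1 + y * z) \<le> norm y * dist x z" for x z
      using norm_mult_ineq[of y "x - z"] by (simp add: dist_norm right_diff_distrib)
  qed (use assms in auto)
  then obtain z where "z \<in> S" "1 + y * z = z" by blast
  then show ?thesis
    by (intro that[of z]) (auto simp: left_diff_distrib diff_eq_eq)
qed

text \<open>
  The equation \<open>(1 - y)\<^sup>2 = 1 - x\<close> reads \<open>y = (x + y\<^sup>2) / 2\<close>, and the right-hand side is a
  contraction of the ball of radius \<open>norm x < 1\<close>.
\<close>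

lemma sqrt_one_minus_in:
  fixes S :: "'a::{real_normed_algebra_1,banach} set"
  assumes "closed S" "0 \<in> S" "\<And>y. y \<in> S \<Longrightarrow> (1/2) *\<^sub>R (x + y * y) \<in> S" "norm x < 1"
  obtains y where "y \<in> S" "(1 - y) * (1 - y) = 1 - x"
proof -
  let ?r = "norm x"
  have "\<exists>!y\<in>S \<inter> cball 0 ?r. (1/2) *\<^sub>R (x + y * y) = y"
  proof (rule Banach_fix[of _ ?r])
    show "complete (S \<inter> cball 0 ?r)" 
      using assms(1) by (auto simp: complete_eq_closed intro: closed_Int)
    show "S \<inter> cball 0 ?r \<noteq> {}" using assms(2) by force
    show "(\<lambda>y. (1/2) *\<^sub>R (x + y * y)) ` (S \<inter> cball 0 ?r) \<subseteq> S \<inter> cball 0 ?r"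
    proof safe
      fix y assume y: "y \<in> S" "y \<in> cball 0 ?r"
      then show "(1/2) *\<^sub>R (x + y * y) \<in> S" using assms(3) by blast
      have "norm (y * y) \<le> ?r * ?r"
        using y norm_mult_ineq[of y y] by (intro order_trans[OF norm_mult_ineq] mult_mono) auto
      also have "\<dots> \<le> ?r * 1"
        using assms(4) by (intro mult_left_mono) auto
      finally show "(1/2) *\<^sub>R (x + y * y) \<in> cball 0 ?r"
        using norm_triangle_ineq[of x "y * y"] by simp
    qed
    show "dist ((1/2) *\<^sub>R (x + y * y)) ((1/2) *\<^sub>R (x + z * z)) \<le> ?r * dist y z"
      if "y \<in> S \<inter> cball 0 ?r" "z \<in> S \<inter> cball 0 ?r" for y z
    proof -
      have eq: "y * y - z * z = y * (y - z) + (y - z) * z"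
        by (simp add: algebra_simps)
      have "norm (y * (y - z)) \<le> ?r * norm (y - z)" "norm ((y - z) * z) \<le> norm (y - z) * ?r"
        using that by (intro order_trans[OF norm_mult_ineq] mult_mono; simp)+
      then have "norm (y * y - z * z) \<le> 2 * ?r * norm (y - z)"
        unfolding eq using norm_triangle_ineq[of "y * (y - z)" "(y - z) * z"]
        by (simp add: mult.commute mult.left_commute)
      moreover have "(1/2) *\<^sub>R (x + y * y) - (1/2) *\<^sub>R (x + z * z) = (1/2) *\<^sub>R (y * y - z * z)"
        by (simp add: algebra_simps)
      ultimately show ?thesis
        by (simp add: dist_norm)
    qed
  qed (use assms in auto)
  then obtain y where y: "y \<in> S" "(1/2) *\<^sub>R (x + y * y) = y" by blast
  then have "x + y * y = 2 *\<^sub>R y"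
    by (metis (no_types) scaleR_one scaleR_scaleR field_sum_of_halves mult_2 nonzero_mult_div_cancel_left one_add_one times_divide_eq_right zero_neq_numeral)
  then have "(1 - y) * (1 - y) = 1 - x"
    by (simp add: algebra_simps scaleR_2)
  with y show ?thesis using that by blast
qed

section \<open>Positive elements\<close>

text \<open>
  The condition says that the spectrum of the self-adjoint \<open>x\<close> lies in \<open>[0, 2 t]\<close> for some \<open>t\<close>.
  In this form positivity is visibly stable under sums, and it does not refer to any subalgebra.
\<close>

definition pos_elem :: "'a::unital_cstar_algebra \<Rightarrow> bool" where
  "pos_elem x \<longleftrightarrow> x\<^sup>\<star> = x \<and> (\<exists>t. norm (of_real t - x) \<le> t)"

lemma pos_elem_add:
  assumes "pos_elem x" "pos_elem y"
  shows "pos_elem (x + y)"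
proof -
  obtain t u where "norm (of_real t - x) \<le> t" "norm (of_real u - y) \<le> u"
    using assms by (auto simp: pos_elem_def)
  then have "norm (of_real (t + u) - (x + y)) \<le> t + u"
    using norm_triangle_ineq[of "of_real t - x" "of_real u - y"] by (simp add: algebra_simps)
  with assms show ?thesis
    unfolding pos_elem_def by (metis star_add)
qed

lemma pos_elem_scaleR:
  assumes "pos_elem x" "0 \<le> r"
  shows "pos_elem (r *\<^sub>R x)"
proof -
  obtain t where "norm (of_real t - x) \<le> t"
    using assms by (auto simp: pos_elem_def)
  moreover have "of_real (r * t) - r *\<^sub>R x = r *\<^sub>R (of_real t - x)"
    by (simp add: of_real_def scaleR_diff_right)
  ultimately have "norm (of_real (r * t) - r *\<^sub>R x) \<le> r * t"
    using assms(2) by (simp add: mult_left_mono)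
  with assms show ?thesis
    unfolding pos_elem_def by (metis star_scaleR)
qed

lemma pos_elem_of_real: "0 \<le> r \<Longrightarrow> pos_elem (of_real r)"
  unfolding pos_elem_def by (auto intro!: exI[of _ r])

text \<open>
  With \<open>r\<close> a self-adjoint square root of \<open>1 - p\<^sup>2\<close> commuting with \<open>p\<close>, the element
  \<open>u = p + \<i> r\<close> is unitary, hence of norm \<open>1\<close>. As \<open>r\<close> is the imaginary part of \<open>u\<close>, its norm is
  at most \<open>1\<close>, and \<open>1 - p\<^sup>2 = r\<^sup>2\<close>.
\<close>

lemma pos_elem_square_aux:
  fixes p :: "'a::unital_cstar_algebra"
  assumes p: "p\<^sup>\<star> = p" "norm p < 1"
  shows "norm (1 - p * p) \<le> 1"
proof -
  \<comment> \<open>a closed set, stable under the fixed point iteration for the square root of \<open>1 - p * p\<close>\<close>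
  let ?S = "{z. z\<^sup>\<star> = z \<and> z * p = p * z}"
  have "closed ?S"
    by (intro closed_Collect_conj closed_Collect_eq continuous_intros)
  moreover have "(1/2) *\<^sub>R (p * p + z * z) \<in> ?S" if "z \<in> ?S" for z
    using that p by (simp add: star_scaleR star_add star_mult distrib_left distrib_right)
      (metis mult.assoc)
  moreover have "norm (p * p) < 1"
    using p norm_mult_ineq[of p p] mult_le_one[of "norm p" "norm p"] mult_strict_mono'[of "norm p" 1 "norm p" 1] by simp
  ultimately obtain y where y: "y \<in> ?S" "(1 - y) * (1 - y) = 1 - p * p"
    using sqrt_one_minus_in[of ?S "p * p"] by auto
  define r where "r = 1 - y"
  have r: "r\<^sup>\<star> = r" "r * p = p * r" "r * r = 1 - p * p"
    using y by (auto simp: r_def star_diff algebra_simps)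
  define u where "u = p + \<i> *\<^sub>C r"
  have us: "u\<^sup>\<star> = p - \<i> *\<^sub>C r"
    using p r by (simp add: u_def star_add star_scaleC scaleC_minus_left)
  have "u\<^sup>\<star> * u = p * p + r * r"
    unfolding us unfolding u_def
    by (simp add: algebra_simps mult_scaleC_left mult_scaleC_right scaleC_scaleC scaleC_minus_one r(2)
        scaleC_diff_right)
  then have "norm u = 1"
    using cstar_identity[of u] r by (simp add: power2_eq_1_iff) (smt (verit) norm_ge_zero)
  moreover have "r = (- \<i> / 2) *\<^sub>C (u - u\<^sup>\<star>)"
    using im_part_eq[of p r] p r by (simp add: im_part_def u_def)
  then have "norm r \<le> (1/2) * (norm u + norm (u\<^sup>\<star>))"
    using norm_triangle_ineq4[of u "u\<^sup>\<star>"] by (metis norm_scaleC mult_left_mono norm_divide norm_ii norm_minus_cancel norm_numeral zero_le_divide_1_iff zero_le_numeral)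
  ultimately have "norm r \<le> 1" by simp
  then have "norm (r * r) \<le> 1"
    using norm_mult_ineq[of r r] mult_le_one[of "norm r" "norm r"] by simp
  then show ?thesis using r by simp
qed

lemma pos_elem_square:
  assumes p: "p\<^sup>\<star> = p"
  shows "pos_elem (p * p)"
proof -
  define c where "c = norm p + 1"
  have c: "c > 0" by (simp add: c_def add_nonneg_pos)
  have "norm ((1/c) *\<^sub>R p) < 1"
    using c by (simp add: c_def divide_simps)
  then have n: "norm (1 - ((1/c) *\<^sub>R p) * ((1/c) *\<^sub>R p)) \<le> 1"
    using p by (intro pos_elem_square_aux) (auto simp: star_scaleR)
  have "of_real (c * c) - p * p = (c * c) *\<^sub>R (1 - ((1/c) *\<^sub>R p) * ((1/c) *\<^sub>R p))"
    using c by (simp add: algebra_simps of_real_def)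
  then have "norm (of_real (c * c) - p * p) \<le> c * c"
    using n c by (simp add: mult_le_cancel_left1 abs_mult)
  then show ?thesis
    using p unfolding pos_elem_def by (metis star_mult)
qed

section \<open>The ordered real algebra of self-adjoint elements\<close>

locale abelian_cstar =
  fixes D :: "'a::unital_cstar_algebra set"
  assumes cstar: "cstar_subalgebra D" and abel: "abelian D" and one_in: "1 \<in> D"
begin

lemma closed_D: "closed D"
  and zero_in: "0 \<in> D"
  and add_in: "x \<in> D \<Longrightarrow> y \<in> D \<Longrightarrow> x + y \<in> D"
  and scaleC_in: "x \<in> D \<Longrightarrow> c *\<^sub>C x \<in> D"
  and mult_in: "x \<in> D \<Longrightarrow> y \<in> D \<Longrightarrow> x * y \<in> D"
  and star_in: "x \<in> D \<Longrightarrow> x\<^sup>\<star> \<in> D"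
  using cstar by (auto simp: cstar_subalgebra_def star_subalgebra_def)

lemma comm: "x \<in> D \<Longrightarrow> y \<in> D \<Longrightarrow> x * y = y * x"
  using abel by (auto simp: abelian_def)

lemma scaleR_in: "x \<in> D \<Longrightarrow> r *\<^sub>R x \<in> D"
  by (simp add: scaleR_conv_scaleC scaleC_in)

lemma uminus_in: "x \<in> D \<Longrightarrow> - x \<in> D"
  using scaleC_in[of x "- 1"] by (simp add: scaleC_minus_one)

lemma diff_in: "x \<in> D \<Longrightarrow> y \<in> D \<Longrightarrow> x - y \<in> D"
  using add_in[of x "- y"] uminus_in by simp

lemma of_real_in: "of_real r \<in> D"
  using scaleR_in[OF one_in] by (simp add: of_real_def)

lemmas D_closed = zero_in one_in add_in scaleC_in mult_in star_in scaleR_in uminus_in diff_in of_real_in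

definition sa :: "'a set" where "sa = {x \<in> D. x\<^sup>\<star> = x}"

lemma sa_in_D: "x \<in> sa \<Longrightarrow> x \<in> D"
  and sa_star: "x \<in> sa \<Longrightarrow> x\<^sup>\<star> = x"
  by (auto simp: sa_def)

lemma sa_comm: "x \<in> sa \<Longrightarrow> y \<in> sa \<Longrightarrow> x * y = y * x"
  by (simp add: comm sa_in_D)

lemma closed_sa: "closed sa"
  unfolding sa_def Collect_conj_eq
  by (intro closed_Int closed_Collect_eq continuous_intros) (simp add: closed_D)

lemma zero_sa: "0 \<in> sa" and one_sa: "1 \<in> sa" and of_real_sa: "of_real r \<in> sa"
  by (simp_all add: sa_def D_closed)

lemma add_sa: "x \<in> sa \<Longrightarrow> y \<in> sa \<Longrightarrow> x + y \<in> sa"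
  and diff_sa: "x \<in> sa \<Longrightarrow> y \<in> sa \<Longrightarrow> x - y \<in> sa"
  and minus_sa: "x \<in> sa \<Longrightarrow> - x \<in> sa"
  and scaleR_sa: "x \<in> sa \<Longrightarrow> r *\<^sub>R x \<in> sa"
  by (simp_all add: sa_def D_closed star_add star_diff star_scaleR)

lemma mult_sa: "x \<in> sa \<Longrightarrow> y \<in> sa \<Longrightarrow> x * y \<in> sa"
  using comm[of x y] by (simp add: sa_def D_closed star_mult)

lemma re_part_sa: "z \<in> D \<Longrightarrow> re_part z \<in> sa"
  and im_part_sa: "z \<in> D \<Longrightarrow> im_part z \<in> sa"
  unfolding sa_def by (simp_all, simp_all only: re_part_def im_part_def D_closed)

lemmas sa_closed = zero_sa one_sa add_sa diff_sa minus_sa scaleR_sa of_real_sa mult_sa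

lemma sqrt_one_minus_sa:
  assumes "x \<in> sa" "norm x < 1"
  obtains s where "s \<in> sa" "s * s = 1 - x"
proof -
  have "(1/2) *\<^sub>R (x + y * y) \<in> sa" if "y \<in> sa" for y
    using assms that by (simp add: sa_closed)
  then obtain y where "y \<in> sa" "(1 - y) * (1 - y) = 1 - x"
    using sqrt_one_minus_in[OF closed_sa zero_sa _ assms(2)] by blast
  then show ?thesis
    by (intro that[of "1 - y"]) (simp_all add: sa_closed)
qed

text \<open>
  Adding \<open>\<delta>\<close> brings \<open>x\<close>, after rescaling, strictly inside the unit ball around \<open>1\<close>, where square
  roots exist.
\<close>

lemma pos_elem_add_sqrt:
  assumes "x \<in> sa" "pos_elem x" "\<delta> > 0"
  obtains s where "s \<in> sa" "s * s = x + of_real \<delta>"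
proof -
  obtain t where t: "norm (of_real t - x) \<le> t" using assms by (auto simp: pos_elem_def)
  have t0: "0 \<le> t" using order_trans[OF norm_ge_zero t] .
  define c where "c = t + \<delta>"
  have c: "c > 0" using t0 assms by (simp add: c_def)
  define y where "y = (1/c) *\<^sub>R (of_real t - x)"
  have "norm y < 1"
    using t c assms by (simp add: y_def c_def divide_simps)
  then obtain s where s: "s \<in> sa" "s * s = 1 - y"
    using sqrt_one_minus_sa[of y] assms by (auto simp: y_def sa_closed)
  have "(sqrt c *\<^sub>R s) * (sqrt c *\<^sub>R s) = c *\<^sub>R (1 - y)"
    using c s by simp
  also have "\<dots> = x + of_real \<delta>"
    using c by (simp add: y_def scaleR_diff_right) (simp add: c_def of_real_def scaleR_left_distrib)
  finally show ?thesis using that[of "sqrt c *\<^sub>R s"] s by (simp add: sa_closed)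
qed

text \<open>
  The bound is approached through \<open>c = t + \<delta>\<close>: now \<open>c - x\<close> and \<open>c + x\<close> are squares \<open>s\<^sup>2\<close> and
  \<open>r\<^sup>2\<close>, so \<open>x\<^sup>2 + (s r)\<^sup>2 = c\<^sup>2\<close>, that is, \<open>x\<close> is the real part of \<open>\<bar>c\<bar>\<close> times a unitary.
\<close>

lemma norm_le_of_pos:
  assumes x: "x \<in> sa" and pos: "pos_elem (of_real t - x)" "pos_elem (of_real t + x)" and "0 < \<delta>"
  shows "norm x \<le> \<bar>t + \<delta>\<bar>"
proof -
  obtain s where s: "s \<in> sa" "s * s = of_real t - x + of_real \<delta>"
    using pos_elem_add_sqrt[of "of_real t - x" \<delta>] assms by (auto simp: sa_closed)
  obtain r where r: "r \<in> sa" "r * r = of_real t + x + of_real \<delta>"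
    using pos_elem_add_sqrt[of "of_real t + x" \<delta>] assms by (auto simp: sa_closed)
  let ?c = "of_real (t + \<delta>) :: 'a"
  have cx: "?c * x = x * ?c" by (simp add: of_real_def)
  have "(s * r) * (s * r) = (s * s) * (r * r)"
    using sa_comm[of r s] s r by (metis mult.assoc)
  also have "\<dots> = (?c - x) * (?c + x)"
    unfolding s(2) r(2) by (simp add: algebra_simps)
  also have "\<dots> = ?c * ?c - x * x"
    using cx by (simp add: ring_distribs)
  finally have q: "(s * r) * (s * r) = ?c * ?c - x * x" .
  define u where "u = x + \<i> *\<^sub>C (s * r)"
  have w: "s * r \<in> sa" using s r by (simp add: sa_closed)
  have us: "u\<^sup>\<star> = x - \<i> *\<^sub>C (s * r)"
    using x w by (simp add: u_def star_add star_scaleC scaleC_minus_left sa_star)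
  have "u\<^sup>\<star> * u = x * x + (s * r) * (s * r)"
    unfolding us unfolding u_def using sa_comm[OF x w]
    by (simp add: ring_distribs mult_scaleC_left mult_scaleC_right scaleC_scaleC scaleC_minus_one
      scaleC_diff_right)
  also have "\<dots> = of_real ((t + \<delta>) * (t + \<delta>))"
    unfolding q by simp
  finally have "(norm u)\<^sup>2 = \<bar>(t + \<delta>)\<bar>\<^sup>2"
    using cstar_identity[of u] by (simp only: norm_of_real) (simp add: power2_eq_square)
  then have "norm u = \<bar>t + \<delta>\<bar>"
    by (metis abs_ge_zero norm_ge_zero power2_eq_imp_eq)
  moreover have "x = (1/2) *\<^sub>R (u + u\<^sup>\<star>)"
    using re_part_eq[of x "s * r"] x w by (simp add: re_part_def u_def sa_star)
  then have "norm x \<le> (1/2) * (norm u + norm (u\<^sup>\<star>))"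
    using norm_triangle_ineq[of u "u\<^sup>\<star>"] 
    by (metis abs_of_pos half_gt_zero_iff mult_left_mono norm_scaleR zero_le_divide_1_iff zero_le_numeral zero_less_one)
  ultimately show ?thesis by simp
qed

section \<open>Maximal preorderings and characters\<close>

definition preordering :: "'a set \<Rightarrow> bool" where
  "preordering Q \<longleftrightarrow> Q \<subseteq> sa \<and> (\<forall>x\<in>sa. x * x \<in> Q) \<and>
     (\<forall>p\<in>Q. \<forall>q\<in>Q. p + q \<in> Q \<and> p * q \<in> Q)"

text \<open>
  Sums of squares form the smallest preordering. They are used instead of the positive elements
  because their stability under products is plain algebra.
\<close>

inductive_set sos :: "'a set" where
  sos_zero: "0 \<in> sos"
| sos_step: "a \<in> sa \<Longrightarrow> p \<in> sos \<Longrightarrow> a * a + p \<in> sos"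

lemma sos_sa: "p \<in> sos \<Longrightarrow> p \<in> sa"
  by (induction rule: sos.induct) (auto simp: sa_closed)

lemma sos_pos: "p \<in> sos \<Longrightarrow> pos_elem p"
  by (induction rule: sos.induct)
    (use pos_elem_of_real[of 0, where 'a = 'a] in \<open>auto simp: pos_elem_add pos_elem_square sa_star\<close>)

lemma sos_add: "p \<in> sos \<Longrightarrow> q \<in> sos \<Longrightarrow> p + q \<in> sos"
  by (induction rule: sos.induct) (auto simp: add.assoc intro: sos_step)

lemma sos_square_mult:
  assumes "b \<in> sa" "p \<in> sos"
  shows "b * b * p \<in> sos"
  using assms(2)
proof (induction rule: sos.induct)
  case (sos_step a p)
  have "b * b * (a * a + p) = (b * a) * (b * a) + b * b * p"
    using sa_comm[of a b] sos_step assms by (simp add: distrib_left) (metis mult.assoc)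
  then show ?case
    using sos_step assms by (auto intro!: sos.sos_step simp: sa_closed)
qed (simp add: sos_zero)

lemma sos_mult: "p \<in> sos \<Longrightarrow> q \<in> sos \<Longrightarrow> p * q \<in> sos"
  by (induction rule: sos.induct) (auto simp: distrib_right sos_zero intro: sos_square_mult sos_add)

lemma sos_square: "a \<in> sa \<Longrightarrow> a * a \<in> sos"
  using sos_step[OF _ sos_zero] by fastforce

lemma preordering_sos: "preordering sos"
  by (auto simp: preordering_def sos_sa sos_square sos_add sos_mult)

text \<open>
  The preordering generated by \<open>Q\<close> and \<open>x\<close>: products stay inside because \<open>x * x \<in> Q\<close>.
\<close>

lemma preordering_extend:
  assumes Q: "preordering Q" and x: "x \<in> sa"
  shows "preordering {p + q * x |p q. p \<in> Q \<and> q \<in> Q}" (is "preordering ?T")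
    and "Q \<subseteq> {p + q * x |p q. p \<in> Q \<and> q \<in> Q}"
    and "x \<in> {p + q * x |p q. p \<in> Q \<and> q \<in> Q}"
proof -
  have sub: "Q \<subseteq> sa" and sq: "\<And>y. y \<in> sa \<Longrightarrow> y * y \<in> Q"
    and add: "\<And>p q. p \<in> Q \<Longrightarrow> q \<in> Q \<Longrightarrow> p + q \<in> Q"
    and mult: "\<And>p q. p \<in> Q \<Longrightarrow> q \<in> Q \<Longrightarrow> p * q \<in> Q"
    using Q by (auto simp: preordering_def)
  have 0: "0 \<in> Q" using sq[OF zero_sa] by simp
  have 1: "1 \<in> Q" using sq[OF one_sa] by simp
  have "x = 0 + 1 * x" by simp
  with 0 1 show "x \<in> ?T" by blast
  show QT: "Q \<subseteq> ?T"
  proof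
    fix p assume "p \<in> Q"
    moreover have "p = p + 0 * x" by simp
    ultimately show "p \<in> ?T" using 0 by blast
  qed
  have "?T \<subseteq> sa"
  proof clarify
    fix p q assume "p \<in> Q" "q \<in> Q"
    with sub x show "p + q * x \<in> sa" by (intro add_sa mult_sa) auto
  qed
  moreover have cl: "(p + q * x) + (p' + q' * x) \<in> ?T" "(p + q * x) * (p' + q' * x) \<in> ?T"
    if "p \<in> Q" "q \<in> Q" "p' \<in> Q" "q' \<in> Q" for p q p' q'
  proof -
    have "(p + q * x) + (p' + q' * x) = (p + p') + (q + q') * x"
      by (simp add: algebra_simps)
    with add[OF that(1,3)] add[OF that(2,4)] show "(p + q * x) + (p' + q' * x) \<in> ?T" by blast
    have c: "x * p' = p' * x" "x * q' = q' * x"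
      using that sub x by (simp_all add: sa_comm subsetD)
    have "(p + q * x) * (p' + q' * x) = p * p' + p * q' * x + q * (x * p') + q * (x * q') * x"
      by (simp add: ring_distribs mult.assoc)
    also have "\<dots> = (p * p' + q * q' * (x * x)) + (p * q' + q * p') * x"
      unfolding c by (simp add: ring_distribs mult.assoc)
    finally have eq: "(p + q * x) * (p' + q' * x) = \<dots>" .
    have "p * p' + q * q' * (x * x) \<in> Q" "p * q' + q * p' \<in> Q"
      using that by (auto intro!: add mult sq[OF x])
    then show "(p + q * x) * (p' + q' * x) \<in> ?T"
      unfolding eq by blast
  qed
  ultimately show "preordering ?T"
    unfolding preordering_def
  proof (intro conjI ballI)
    show "y * y \<in> ?T" if "y \<in> sa" for y using sq[OF that] QT by (rule subsetD[rotated])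
    fix u v assume "u \<in> ?T" "v \<in> ?T"
    then obtain p q p' q' where "p \<in> Q" "q \<in> Q" "p' \<in> Q" "q' \<in> Q" "u = p + q * x" "v = p' + q' * x"
      by blast
    then show "u + v \<in> ?T" "u * v \<in> ?T" using cl by simp_all
  qed
qed

text \<open>
  As \<open>p\<close> is within \<open>t\<close> of \<open>t\<close>, the element \<open>1 + p\<close> is \<open>t + 1\<close> times some \<open>1 - y\<close> with
  \<open>norm y < 1\<close>. The inverse \<open>z\<close> of \<open>1 - y = s\<^sup>2\<close> is the square \<open>(z s)\<^sup>2\<close>.
\<close>

lemma one_plus_sos_inverse:
  assumes "p \<in> sos"
  obtains z where "z \<in> sos" "z * (1 + p) = 1"
proof -
  obtain t where t: "norm (of_real t - p) \<le> t" 
    using sos_pos[OF assms] by (auto simp: pos_elem_def)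
  have t0: "0 \<le> t" using order_trans[OF norm_ge_zero t] .
  define y where "y = (1/(t+1)) *\<^sub>R (of_real t - p)"
  have y: "y \<in> sa" "norm y < 1"
    using t t0 assms by (auto simp: y_def sa_closed sos_sa)
  have p1: "(t + 1) *\<^sub>R (1 - y) = 1 + p"
    using t0 by (simp add: y_def scaleR_diff_right) (simp add: of_real_def algebra_simps)
  obtain s where s: "s \<in> sa" "s * s = 1 - y" using sqrt_one_minus_sa[OF y] .
  obtain z where z: "z \<in> sa" "(1 - y) * z = 1"
    using one_minus_invertible_in[OF closed_sa one_sa add_sa mult_sa y] by blast
  have "(z * s) * (z * s) = (z * s) * (s * z)"
    using sa_comm[of s z] s z by simp
  also have "\<dots> = z * (s * s) * z"
    by (simp add: mult.assoc)
  also have "\<dots> = z"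
    unfolding s(2) using z(2) by (simp add: mult.assoc)
  finally have "z \<in> sos" using sos_square[of "z * s"] s z by (simp add: sa_closed)
  \<comment> \<open>\<open>c * c\<close> rescales the inverse of \<open>1 - y\<close> to that of \<open>1 + p\<close> and is itself a square\<close>
  define c where "c = sqrt (1 / (t + 1))"
  have cc: "c * c = 1 / (t + 1)" using t0 by (simp add: c_def)
  have "of_real c * of_real c * z \<in> sos"
    using \<open>z \<in> sos\<close> sos_square_mult[of "of_real c"] by (simp add: of_real_sa)
  moreover have "of_real c * of_real c * z * (1 + p) = 1"
  proof -
    have "z * (1 - y) = 1"
      using z y sa_comm[of z "1 - y"] by (simp add: sa_closed)
    have "of_real c * of_real c * z * (1 + p) = (c * c * (t + 1)) *\<^sub>R (z * (1 - y))"
      unfolding p1[symmetric] by (simp add: of_real_def mult_ac)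
    then show ?thesis using \<open>z * (1 - y) = 1\<close> t0 unfolding cc by simp
  qed
  ultimately show ?thesis using that by blast
qed

text \<open>
  If \<open>- 1 = p - q x\<close> with \<open>p\<close>, \<open>q\<close> sums of squares, then \<open>q x = 1 + p\<close> is invertible with an inverse
  \<open>z\<close> that is a sum of squares, so \<open>x = z (q x) x = z q x\<^sup>2\<close> is a sum of squares as well.
\<close>

lemma proper_preordering_of_not_pos:
  assumes x: "x \<in> sa" and "\<not> pos_elem x"
  shows "- 1 \<notin> {p + q * (- x) |p q. p \<in> sos \<and> q \<in> sos}"
proof
  assume "- 1 \<in> {p + q * (- x) |p q. p \<in> sos \<and> q \<in> sos}"
  then obtain p q where pq: "p \<in> sos" "q \<in> sos" "- 1 = p + q * (- x)" by blast
  then have qx: "q * x = 1 + p" by (simp add: algebra_simps)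
  obtain z where z: "z \<in> sos" "z * (1 + p) = 1" using one_plus_sos_inverse[OF pq(1)] .
  have "x = z * (q * x) * x" using qx z by simp
  also have "\<dots> = z * q * (x * x)" by (simp add: mult.assoc)
  finally have "x = z * q * (x * x)" .
  moreover have "z * q * (x * x) \<in> sos"
    by (intro sos_mult sos_square z pq x)
  ultimately show False using assms sos_pos[of x] by simp
qed

lemma maximal_preordering_exists:
  assumes T: "preordering T" "- 1 \<notin> T"
  obtains Q where "T \<subseteq> Q" "preordering Q" "- 1 \<notin> Q"
    "\<And>Q'. preordering Q' \<Longrightarrow> - 1 \<notin> Q' \<Longrightarrow> Q \<subseteq> Q' \<Longrightarrow> Q' = Q"
proof -
  let ?A = "{Q. T \<subseteq> Q \<and> preordering Q \<and> - 1 \<notin> Q}"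
  have "\<exists>M\<in>?A. \<forall>X\<in>?A. M \<subseteq> X \<longrightarrow> X = M"
  proof (rule subset_Zorn_nonempty)
    show "?A \<noteq> {}" using T by blast
    fix C assume C: "C \<noteq> {}" "subset.chain ?A C"
    have CA: "\<And>X. X \<in> C \<Longrightarrow> T \<subseteq> X \<and> preordering X \<and> - 1 \<notin> X"
      and lin: "\<And>X Y. X \<in> C \<Longrightarrow> Y \<in> C \<Longrightarrow> X \<subseteq> Y \<or> Y \<subseteq> X"
      using C by (auto simp: subset.chain_def)
    have "preordering (\<Union>C)"
      unfolding preordering_def
    proof (intro conjI ballI)
      show "\<Union>C \<subseteq> sa" using CA unfolding preordering_def by blast
      show "x * x \<in> \<Union>C" if "x \<in> sa" for x using C CA that by (auto simp: preordering_def)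
      fix p q assume "p \<in> \<Union>C" "q \<in> \<Union>C"
      then obtain X where "X \<in> C" "p \<in> X" "q \<in> X" using lin by blast
      then show "p + q \<in> \<Union>C" "p * q \<in> \<Union>C" using CA by (auto simp: preordering_def)
    qed
    moreover have "T \<subseteq> \<Union>C"
      using C(1) CA by (metis Sup_upper2 all_not_in_conv)
    moreover have "- 1 \<notin> \<Union>C" using CA by auto
    ultimately show "\<Union>C \<in> ?A" by simp
  qed
  then obtain M where M: "M \<in> ?A" "\<forall>X\<in>?A. M \<subseteq> X \<longrightarrow> X = M" ..
  show ?thesis
  proof (rule that[of M])
    show "Q' = M" if "preordering Q'" "- 1 \<notin> Q'" "M \<subseteq> Q'" for Q'
      using M that by (metis (mono_tags, lifting) mem_Collect_eq order_trans)
  qed (use M in simp_all)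
qed

text \<open>
  Every self-adjoint element is dominated by a real number, since \<open>1 - x / c\<close> is a square for
  \<open>c > norm x\<close>. This makes every ordering of \<open>sa\<close> Archimedean over the reals.
\<close>

lemma sa_order_unit:
  assumes "preordering Q" "x \<in> sa"
  shows "of_real (norm x + 1) - x \<in> Q"
proof -
  define c where "c = norm x + 1"
  have c: "c > 0" by (simp add: c_def add_nonneg_pos)
  have "norm ((1/c) *\<^sub>R x) < 1" using c by (simp add: c_def divide_simps)
  then obtain s where s: "s \<in> sa" "s * s = 1 - (1/c) *\<^sub>R x"
    using sqrt_one_minus_sa[of "(1/c) *\<^sub>R x"] assms by (auto simp: sa_closed)
  have "(sqrt c *\<^sub>R s) * (sqrt c *\<^sub>R s) = of_real c - x"
    using c s by (simp add: scaleR_diff_right of_real_def)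
  moreover have "(sqrt c *\<^sub>R s) * (sqrt c *\<^sub>R s) \<in> Q"
    using assms(1) scaleR_sa[OF s(1)] unfolding preordering_def by blast
  ultimately show ?thesis by (simp add: c_def)
qed

end

locale maximal_preordering = abelian_cstar +
  fixes Q
  assumes Q: "preordering Q" and proper: "- 1 \<notin> Q"
    and maximal: "\<And>Q'. preordering Q' \<Longrightarrow> - 1 \<notin> Q' \<Longrightarrow> Q \<subseteq> Q' \<Longrightarrow> Q' = Q"
begin

lemma Q_sa: "x \<in> Q \<Longrightarrow> x \<in> sa"
  and Q_square: "x \<in> sa \<Longrightarrow> x * x \<in> Q"
  and Q_add: "x \<in> Q \<Longrightarrow> y \<in> Q \<Longrightarrow> x + y \<in> Q"
  and Q_mult: "x \<in> Q \<Longrightarrow> y \<in> Q \<Longrightarrow> x * y \<in> Q"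
  using Q by (auto simp: preordering_def)

text \<open>
  If neither \<open>x\<close> nor \<open>- x\<close> is in \<open>Q\<close>, maximality gives \<open>- 1 = p + q x\<close> and \<open>- 1 = p' - q' x\<close>.
  Multiplying \<open>q x = - (1 + p)\<close> by \<open>q' x = 1 + p'\<close> gives \<open>- 1 \<in> Q\<close>.
\<close>

lemma Q_total:
  assumes x: "x \<in> sa"
  shows "x \<in> Q \<or> - x \<in> Q"
proof (rule ccontr)
  assume "\<not> ?thesis"
  then have neg: "x \<notin> Q" "- x \<notin> Q" by auto
  have "- 1 \<in> {p + q * y |p q. p \<in> Q \<and> q \<in> Q}" if "y \<in> sa" "y \<notin> Q" for y
  proof (rule ccontr)
    assume "- 1 \<notin> {p + q * y |p q. p \<in> Q \<and> q \<in> Q}"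
    from maximal[OF preordering_extend(1)[OF Q that(1)] this preordering_extend(2)[OF Q that(1)]]
      preordering_extend(3)[OF Q that(1)] that(2)
    show False by simp
  qed
  from this[OF x neg(1)] this[OF minus_sa[OF x] neg(2)]
  obtain p q p' q' where *: "p \<in> Q" "q \<in> Q" "p' \<in> Q" "q' \<in> Q"
    "- 1 = p + q * x" "- 1 = p' + q' * (- x)" by blast
  have "q * x = (p + q * x) - p" "q' * x = p' - (p' + q' * (- x))"
    by simp_all
  then have qx: "q * x = - (1 + p)" "q' * x = 1 + p'"
    unfolding *(5,6)[symmetric] by (simp_all add: algebra_simps)
  have "(q * q') * (x * x) = (q * x) * (q' * x)"
    using *(1-4) x sa_comm[of q' x] Q_sa by (simp add: mult.assoc) (metis mult.assoc)
  also have "\<dots> = - (1 + p + p' + p * p')"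
    unfolding qx by (simp add: algebra_simps)
  finally have "- 1 = p + p' + p * p' + (q * q') * (x * x)"
    by (simp add: algebra_simps)
  then have "- 1 \<in> Q" using * x by (metis Q_add Q_mult Q_square)
  then show False using proper by blast
qed

lemma Q_of_real: "0 \<le> r \<Longrightarrow> of_real r \<in> Q"
  using Q_square[OF of_real_sa[of "sqrt r"]] by (simp flip: of_real_mult)

lemma Q_of_real_nonneg:
  assumes "of_real r \<in> Q" 
  shows "0 \<le> r"
proof (rule ccontr)
  assume "\<not> 0 \<le> r"
  then have "of_real (1 / - r) * of_real r \<in> Q" 
    by (intro Q_mult[OF Q_of_real assms]) auto
  also have "of_real (1 / - r) * of_real r = (- 1 :: 'a)"
    using \<open>\<not> 0 \<le> r\<close> by (simp flip: of_real_mult)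
  finally show False using proper by blast
qed

text \<open>
  The position of \<open>x\<close> in the total order given by \<open>Q\<close>, relative to the real numbers.
\<close>

definition val :: "'a \<Rightarrow> real" where
  "val x = Sup {r. x - of_real r \<in> Q}"

lemma val_set:
  assumes x: "x \<in> sa"
  shows "{r. x - of_real r \<in> Q} \<noteq> {}" "bdd_above {r. x - of_real r \<in> Q}"
proof -
  have "x - of_real (- (norm x + 1)) \<in> Q"
    using sa_order_unit[OF Q minus_sa[OF x]] by (simp add: algebra_simps)
  then show "{r. x - of_real r \<in> Q} \<noteq> {}" by blast
  have "r \<le> norm x + 1" if "x - of_real r \<in> Q" for r
  proof -
    have "of_real (norm x + 1 - r) \<in> Q"
      using Q_add[OF that sa_order_unit[OF Q x]] by (simp add: algebra_simps)
    from Q_of_real_nonneg[OF this] show ?thesis by simp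
  qed
  then show "bdd_above {r. x - of_real r \<in> Q}" unfolding bdd_above_def by blast
qed

lemma val_lower:
  assumes x: "x \<in> sa" and "r < val x"
  shows "x - of_real r \<in> Q"
proof -
  obtain s where s: "x - of_real s \<in> Q" "r < s"
    using assms val_set[OF x] less_cSup_iff[of "{r. x - of_real r \<in> Q}" r] by (auto simp: val_def)
  have "(x - of_real s) + of_real (s - r) \<in> Q"
    using s by (intro Q_add Q_of_real) auto
  then show ?thesis by (simp add: algebra_simps)
qed

lemma val_upper:
  assumes x: "x \<in> sa" and "val x < r"
  shows "of_real r - x \<in> Q"
proof -
  have "x - of_real r \<notin> Q"
    using assms val_set[OF x] cSup_upper[of r "{r. x - of_real r \<in> Q}"] by (auto simp: val_def)
  then show ?thesis
    using Q_total[of "x - of_real r"] x by (auto simp: sa_closed)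
qed

lemma val_eqI:
  assumes x: "x \<in> sa" and "\<And>e. e > 0 \<Longrightarrow> x - of_real (c - e) \<in> Q"
    and "\<And>e. e > 0 \<Longrightarrow> of_real (c + e) - x \<in> Q"
  shows "val x = c"
proof (rule antisym)
  show "val x \<le> c"
  proof (rule ccontr)
    assume "\<not> ?thesis"
    \<comment> \<open>the gap of \<open>4 e\<close> leaves room for an error \<open>e\<close> on both sides\<close>
    define e where "e = (val x - c) / 4"
    have e: "e > 0" using \<open>\<not> val x \<le> c\<close> by (simp add: e_def)
    have "(x - of_real (val x - e)) + (of_real (c + e) - x) \<in> Q"
      using e by (intro Q_add val_lower assms) auto
    moreover have "(x - of_real (val x - e)) + (of_real (c + e) - x) = of_real (c + e - (val x - e))"
      by (simp only: of_real_add of_real_diff) (simp add: algebra_simps)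
    ultimately have "of_real (c + e - (val x - e)) \<in> Q" by (simp only:)
    from Q_of_real_nonneg[OF this] e show False by (simp add: e_def field_simps)
  qed
  show "c \<le> val x"
  proof (rule ccontr)
    assume "\<not> ?thesis"
    define e where "e = (c - val x) / 4"
    have e: "e > 0" using \<open>\<not> c \<le> val x\<close> by (simp add: e_def)
    have "(x - of_real (c - e)) + (of_real (val x + e) - x) \<in> Q"
      using e by (intro Q_add val_upper assms) auto
    moreover have "(x - of_real (c - e)) + (of_real (val x + e) - x) = of_real (val x + e - (c - e))"
      by (simp only: of_real_add of_real_diff) (simp add: algebra_simps)
    ultimately have "of_real (val x + e - (c - e)) \<in> Q" by (simp only:)
    from Q_of_real_nonneg[OF this] e show False by (simp add: e_def field_simps)
  qed
qed

lemma val_of_real: "val (of_real r) = r"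
  by (rule val_eqI) (auto simp: of_real_sa Q_of_real simp flip: of_real_diff)

lemma val_add:
  assumes "x \<in> sa" "y \<in> sa"
  shows "val (x + y) = val x + val y"
proof (rule val_eqI)
  fix e :: real assume "e > 0"
  define f where "f = e / 2"
  have f: "f > 0" "e = f + f" using \<open>e > 0\<close> by (auto simp: f_def)
  have "(x - of_real (val x - f)) + (y - of_real (val y - f)) \<in> Q"
    "(of_real (val x + f) - x) + (of_real (val y + f) - y) \<in> Q"
    using assms f by (intro Q_add val_lower val_upper; simp)+
  moreover have "(x - of_real (val x - f)) + (y - of_real (val y - f))
      = x + y - of_real (val x + val y - e)"
    unfolding f(2) of_real_add of_real_diff by (simp add: algebra_simps)
  moreover have "(of_real (val x + f) - x) + (of_real (val y + f) - y)
      = of_real (val x + val y + e) - (x + y)"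
    unfolding f(2) of_real_add of_real_diff by (simp add: algebra_simps)
  ultimately show "x + y - of_real (val x + val y - e) \<in> Q" "of_real (val x + val y + e) - (x + y) \<in> Q"
    by (simp_all only:)
qed (use assms in \<open>simp add: sa_closed\<close>)

lemma val_minus: "x \<in> sa \<Longrightarrow> val (- x) = - val x"
  using val_add[of x "- x"] val_of_real[of 0] by (simp add: sa_closed)

lemma val_diff: "x \<in> sa \<Longrightarrow> y \<in> sa \<Longrightarrow> val (x - y) = val x - val y"
  using val_add[of x "- y"] by (simp add: sa_closed val_minus)

lemma val_scaleR_pos:
  assumes x: "x \<in> sa" and r: "r > 0"
  shows "val (r *\<^sub>R x) = r * val x"
proof (rule val_eqI)
  fix e :: real assume "e > 0"
  then have "of_real r * (x - of_real (val x - e/r)) \<in> Q" "of_real r * (of_real (val x + e/r) - x) \<in> Q"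
    using assms by (intro Q_mult val_lower val_upper Q_of_real; simp)+
  then show "r *\<^sub>R x - of_real (r * val x - e) \<in> Q" "of_real (r * val x + e) - r *\<^sub>R x \<in> Q"
    using r by (simp_all add: of_real_def algebra_simps)
qed (use assms in \<open>simp add: sa_closed\<close>)

lemma val_scaleR:
  assumes x: "x \<in> sa"
  shows "val (r *\<^sub>R x) = r * val x"
proof (cases r "0::real" rule: linorder_cases)
  case less
  have "val (- ((- r) *\<^sub>R x)) = - ((- r) * val x)"
    using val_scaleR_pos[OF x, of "- r"] less x by (subst val_minus) (auto simp: sa_closed)
  then show ?thesis by simp
qed (use val_scaleR_pos[OF x, of r] val_of_real[of 0] in auto)

text \<open>
  From \<open>- sqrt e \<le> x \<le> sqrt e\<close> follows \<open>x\<^sup>2 \<le> e\<close>, by multiplying \<open>sqrt e - x\<close> and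
  \<open>sqrt e + x\<close>.
\<close>

lemma val_square_zero:
  assumes x: "x \<in> sa" and "val x = 0"
  shows "val (x * x) = 0"
proof (rule val_eqI)
  fix e :: real assume e: "e > 0"
  show "x * x - of_real (0 - e) \<in> Q"
    using Q_add[OF Q_square[OF x] Q_of_real[of e]] e by simp
  have sx: "of_real (sqrt e) * x = x * of_real (sqrt e)" by (simp add: of_real_def)
  have "(x - of_real (- sqrt e)) * (of_real (sqrt e) - x) \<in> Q"
    using e x assms by (intro Q_mult val_lower val_upper) auto
  moreover have "(x - of_real (- sqrt e)) * (of_real (sqrt e) - x) = of_real (sqrt e) * of_real (sqrt e) - x * x"
    using sx by (simp add: ring_distribs)
  ultimately show "of_real (0 + e) - x * x \<in> Q"
    using e by (simp flip: of_real_mult)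
qed (use assms in \<open>simp add: sa_closed\<close>)

lemma val_square:
  assumes x: "x \<in> sa"
  shows "val (x * x) = val x * val x"
proof -
  define c where "c = val x"
  define y where "y = x - of_real c"
  have y: "y \<in> sa" "val y = 0"
    using x by (auto simp: y_def sa_closed val_diff val_of_real c_def)
  have "x * x = y * y + (2 * c) *\<^sub>R x - of_real (c * c)"
    by (simp add: y_def of_real_def algebra_simps scaleR_2 flip: scaleR_scaleR)
  then have "val (x * x) = 0 + 2 * c * c - c * c"
    using x y by (simp add: val_diff val_add val_scaleR val_of_real val_square_zero sa_closed c_def del: of_real_mult)
  then show ?thesis by (simp add: c_def)
qed

text \<open>
  Multiplicativity is the polarization of \<open>val_square\<close>.
\<close>

lemma val_mult:
  assumes "x \<in> sa" "y \<in> sa"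
  shows "val (x * y) = val x * val y"
proof -
  have "(x + y) * (x + y) = x * x + y * y + 2 *\<^sub>R (x * y)"
    using sa_comm[OF assms] by (simp add: algebra_simps scaleR_2)
  moreover have "val ((x + y) * (x + y)) = (val x + val y) * (val x + val y)"
    using assms by (simp add: val_square val_add sa_closed)
  ultimately have "(val x + val y) * (val x + val y) = val x * val x + val y * val y + 2 * val (x * y)"
    using assms by (simp add: val_square val_add val_scaleR sa_closed)
  then show ?thesis by (simp add: algebra_simps)
qed

lemma val_nonneg:
  assumes "x \<in> Q"
  shows "0 \<le> val x"
  using cSup_upper[of 0 "{r. x - of_real r \<in> Q}"] val_set[OF Q_sa[OF assms]] assms 
  by (simp add: val_def)

text \<open>
  The complex-linear extension of \<open>val\<close> to \<open>D\<close>, made undefined off \<open>D\<close> as \<^const>\<open>characters\<close>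
  requires.
\<close>

definition order_character :: "'a \<Rightarrow> complex" where
  "order_character = (\<lambda>x\<in>D. Complex (val (re_part x)) (val (im_part x)))"

lemma order_character_eq:
  assumes "h \<in> sa" "k \<in> sa"
  shows "order_character (h + \<i> *\<^sub>C k) = Complex (val h) (val k)"
  using assms by (simp add: order_character_def re_part_eq im_part_eq sa_star D_closed sa_in_D)

lemma order_character_sa: "h \<in> sa \<Longrightarrow> order_character h = of_real (val h)"
  using order_character_eq[of h 0] val_of_real[of 0] scaleC_minus_right[of \<i> "0::'a"] scaleC_diff_right[of \<i> 0 "0::'a"]
  by (simp add: zero_sa complex_of_real_def)

lemma order_character_is_character: "order_character \<in> characters D"
  unfolding characters_def
proof (intro CollectI conjI ballI allI)
  show "order_character \<in> extensional D" by (simp add: order_character_def)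
  fix x y assume xy: "x \<in> D" "y \<in> D"
  define h k h' k' where hk: "h = re_part x" "k = im_part x" "h' = re_part y" "k' = im_part y"
  have sa: "h \<in> sa" "k \<in> sa" "h' \<in> sa" "k' \<in> sa"
    using xy by (auto simp: hk re_part_sa im_part_sa)
  have x: "x = h + \<i> *\<^sub>C k" and y: "y = h' + \<i> *\<^sub>C k'"
    by (auto simp: hk simp flip: re_im_decomp)
  have add: "x + y = (h + h') + \<i> *\<^sub>C (k + k')"
    unfolding x y by (simp add: scaleC_add_right)
  show "order_character (x + y) = order_character x + order_character y"
    unfolding add unfolding x y using sa by (simp add: order_character_eq sa_closed val_add complex_eq_iff)
  have mult: "x * y = (h * h' - k * k') + \<i> *\<^sub>C (h * k' + k * h')"
    unfolding x y
    by (simp add: ring_distribs mult_scaleC_left mult_scaleC_right scaleC_scaleC scaleC_minus_one scaleC_add_right)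
  show "order_character (x * y) = order_character x * order_character y"
    unfolding mult unfolding x y using sa 
    by (simp add: order_character_eq sa_closed val_add val_diff val_mult complex_eq_iff)
next
  fix c x assume "x \<in> D"
  define h k where hk: "h = re_part x" "k = im_part x"
  have sa: "h \<in> sa" "k \<in> sa"
    using \<open>x \<in> D\<close> by (auto simp: hk re_part_sa im_part_sa)
  have x: "x = h + \<i> *\<^sub>C k"
    by (auto simp: hk simp flip: re_im_decomp)
  have "c *\<^sub>C x = (of_real (Re c) + \<i> * of_real (Im c)) *\<^sub>C x" by (simp flip: complex_eq)
  also have "\<dots> = (Re c *\<^sub>R h - Im c *\<^sub>R k) + \<i> *\<^sub>C (Re c *\<^sub>R k + Im c *\<^sub>R h)"
    unfolding x by (simp add: scaleC_add_left scaleC_add_right scaleC_scaleC scaleR_conv_scaleC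
      scaleC_minus_left scaleC_diff_left distrib_left mult.commute mult.left_commute)
  finally show "order_character (c *\<^sub>C x) = c * order_character x"
    unfolding x using sa by (simp add: order_character_eq sa_closed val_add val_diff val_scaleR complex_eq_iff)
next
  have "order_character 1 = 1"
    using order_character_sa[OF one_sa] val_of_real[of 1] by simp
  then show "\<exists>x\<in>D. order_character x \<noteq> 0"
    using one_in by force
qed

end

context abelian_cstar
begin

lemma character_of_not_pos:
  assumes x: "x \<in> sa" and "\<not> pos_elem x"
  obtains \<phi> where "\<phi> \<in> characters D" "Re (\<phi> x) \<le> 0"
proof -
  let ?T = "{p + q * (- x) |p q. p \<in> sos \<and> q \<in> sos}"
  have T: "preordering ?T" "- x \<in> ?T"
    using preordering_extend[OF preordering_sos minus_sa[OF x]] by auto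
  obtain Q where M: "?T \<subseteq> Q" "preordering Q" "- 1 \<notin> Q"
    "\<And>Q'. preordering Q' \<Longrightarrow> - 1 \<notin> Q' \<Longrightarrow> Q \<subseteq> Q' \<Longrightarrow> Q' = Q"
    using maximal_preordering_exists[OF T(1) proper_preordering_of_not_pos[OF assms]] by blast
  interpret maximal_preordering D Q
    by unfold_locales (use M in auto)
  have "val x \<le> 0"
    using val_nonneg[OF subsetD[OF M(1) T(2)]] x by (simp add: val_minus)
  then show ?thesis
    using that[OF order_character_is_character] order_character_sa[OF x] by simp
qed

section \<open>The Gelfand representation\<close>

lemma character_add: "\<phi> \<in> characters D \<Longrightarrow> x \<in> D \<Longrightarrow> y \<in> D \<Longrightarrow> \<phi> (x + y) = \<phi> x + \<phi> y"
  and character_scaleC: "\<phi> \<in> characters D \<Longrightarrow> x \<in> D \<Longrightarrow> \<phi> (c *\<^sub>C x) = c * \<phi> x"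
  and character_mult: "\<phi> \<in> characters D \<Longrightarrow> x \<in> D \<Longrightarrow> y \<in> D \<Longrightarrow> \<phi> (x * y) = \<phi> x * \<phi> y"
  by (simp_all add: characters_def)

lemma character_one:
  assumes "\<phi> \<in> characters D"
  shows "\<phi> 1 = 1"
proof -
  obtain x where "x \<in> D" "\<phi> x \<noteq> 0" using assms by (auto simp: characters_def)
  then show ?thesis using character_mult[OF assms one_in, of x] by simp
qed

lemma character_scaleR: "\<phi> \<in> characters D \<Longrightarrow> x \<in> D \<Longrightarrow> \<phi> (r *\<^sub>R x) = of_real r * \<phi> x"
  by (simp add: scaleR_conv_scaleC character_scaleC)

lemma character_of_real: "\<phi> \<in> characters D \<Longrightarrow> \<phi> (of_real r) = of_real r"
  by (simp add: of_real_def[where 'a = 'a] character_scaleR character_one one_in)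

lemma character_minus: "\<phi> \<in> characters D \<Longrightarrow> x \<in> D \<Longrightarrow> \<phi> (- x) = - \<phi> x"
  using character_scaleC[of \<phi> x "- 1"] by (simp add: scaleC_minus_one)

lemma character_diff: "\<phi> \<in> characters D \<Longrightarrow> x \<in> D \<Longrightarrow> y \<in> D \<Longrightarrow> \<phi> (x - y) = \<phi> x - \<phi> y"
  using character_add[of \<phi> x "- y"] by (simp add: character_minus D_closed)

lemma power_in: "x \<in> D \<Longrightarrow> x ^ n \<in> D"
  by (induction n) (simp_all add: D_closed)

lemma character_power: "\<phi> \<in> characters D \<Longrightarrow> x \<in> D \<Longrightarrow> \<phi> (x ^ n) = \<phi> x ^ n"
  by (induction n) (simp_all add: character_one character_mult power_in)

text \<open>
  Otherwise \<open>y = x / \<phi> x\<close> has norm below \<open>1\<close>, so \<open>1 - y\<close> is invertible in \<open>D\<close>, although \<open>\<phi>\<close>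
  sends it to \<open>0\<close>.
\<close>

lemma character_bound:
  assumes \<phi>: "\<phi> \<in> characters D" and x: "x \<in> D"
  shows "cmod (\<phi> x) \<le> norm x"
proof (rule ccontr)
  assume "\<not> ?thesis"
  then have gt: "norm x < cmod (\<phi> x)" by simp
  then have nz: "\<phi> x \<noteq> 0" using norm_ge_zero[of x] by auto
  define y where "y = (1 / \<phi> x) *\<^sub>C x"
  have y: "y \<in> D" "norm y < 1" "\<phi> y = 1"
    using x gt nz by (auto simp: y_def D_closed norm_scaleC norm_divide character_scaleC[OF \<phi>])
  obtain z where z: "z \<in> D" "(1 - y) * z = 1"
    using one_minus_invertible_in[OF closed_D one_in add_in mult_in y(1,2)] by blast
  have "\<phi> ((1 - y) * z) = 0"
    using y z(1) by (simp add: character_mult[OF \<phi>] character_diff[OF \<phi>] character_one[OF \<phi>] D_closed)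
  then show False using z character_one[OF \<phi>] by simp
qed

text \<open>
  Compare \<open>\<phi>\<close> and the norm at \<open>x + \<i> t\<close>: with \<open>b = Im (\<phi> x)\<close> one gets
  \<open>(b + t)\<^sup>2 \<le> (norm x)\<^sup>2 + t\<^sup>2\<close> for every real \<open>t\<close>, which is impossible for \<open>b \<noteq> 0\<close>.
\<close>

lemma character_sa_real:
  assumes \<phi>: "\<phi> \<in> characters D" and x: "x \<in> sa"
  shows "Im (\<phi> x) = 0"
proof (rule ccontr)
  assume "Im (\<phi> x) \<noteq> 0"
  define b where "b = Im (\<phi> x)"
  have b: "b \<noteq> 0" using \<open>Im (\<phi> x) \<noteq> 0\<close> by (simp add: b_def)
  \<comment> \<open>chosen so that \<open>2 * b * t\<close> exceeds \<open>(norm x)\<^sup>2\<close>\<close>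
  define t where "t = ((norm x)\<^sup>2 + 1) / (2 * b)"
  define y where "y = x + \<i> *\<^sub>C of_real t"
  have yD: "y \<in> D" using x by (simp add: y_def D_closed sa_in_D)
  have tx: "of_real t * x = x * of_real t" by (simp add: of_real_def)
  have "y\<^sup>\<star> * y = x * x + of_real (t * t)"
    using sa_star[OF x] tx by (simp add: y_def star_add star_scaleC ring_distribs mult_scaleC_left
        mult_scaleC_right scaleC_scaleC scaleC_minus_left scaleC_minus_one scaleC_diff_right)
  then have "(norm y)\<^sup>2 \<le> norm (x * x) + norm (of_real (t * t) :: 'a)"
    using cstar_identity[of y] norm_triangle_ineq[of "x * x" "of_real (t * t)"] by simp
  also have "\<dots> \<le> (norm x)\<^sup>2 + t\<^sup>2"
    using norm_mult_ineq[of x x] by (simp only: norm_of_real) (simp add: power2_eq_square)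
  finally have y: "(norm y)\<^sup>2 \<le> (norm x)\<^sup>2 + t\<^sup>2" .
  have "\<phi> y = \<phi> x + \<i> * of_real t"
    using x by (simp add: y_def character_add[OF \<phi>] character_scaleC[OF \<phi>] character_of_real[OF \<phi>] D_closed sa_in_D)
  then have "\<bar>b + t\<bar> \<le> cmod (\<phi> y)"
    using abs_Im_le_cmod[of "\<phi> y"] by (simp add: b_def)
  also have "\<dots> \<le> norm y" by (rule character_bound[OF \<phi> yD])
  finally have "(b + t)\<^sup>2 \<le> (norm y)\<^sup>2"
    by (rule abs_le_square_iff[THEN iffD1, of _ "norm y", simplified])
  with y have "b\<^sup>2 + 2 * b * t \<le> (norm x)\<^sup>2"
    by (simp add: power2_sum)
  moreover have "2 * b * t = (norm x)\<^sup>2 + 1"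
    using b by (simp add: t_def)
  ultimately show False using zero_le_power2[of b] by linarith
qed

lemma character_sa: "\<phi> \<in> characters D \<Longrightarrow> x \<in> sa \<Longrightarrow> \<phi> x = of_real (Re (\<phi> x))"
  by (simp add: complex_eq_iff character_sa_real)

lemma character_decomp:
  assumes \<phi>: "\<phi> \<in> characters D" and x: "x \<in> D"
  shows "\<phi> x = \<phi> (re_part x) + \<i> * \<phi> (im_part x)"
  using x re_part_sa[OF x] im_part_sa[OF x]
  by (subst re_im_decomp[of x]) (simp add: character_add[OF \<phi>] character_scaleC[OF \<phi>] D_closed sa_in_D)

lemma character_star:
  assumes \<phi>: "\<phi> \<in> characters D" and x: "x \<in> D"
  shows "\<phi> (x\<^sup>\<star>) = cnj (\<phi> x)"
proof -
  define h k where hk: "h = re_part x" "k = im_part x"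
  have sa: "h \<in> sa" "k \<in> sa" using x by (simp_all add: hk re_part_sa im_part_sa)
  have x: "x = h + \<i> *\<^sub>C k" by (simp add: hk flip: re_im_decomp)
  have xs: "x\<^sup>\<star> = h - \<i> *\<^sub>C k"
    using sa by (simp add: x star_add star_scaleC scaleC_minus_left sa_star)
  show ?thesis
    unfolding xs unfolding x using sa character_sa_real[OF \<phi>] 
    by (simp add: character_add[OF \<phi>] character_diff[OF \<phi>] character_scaleC[OF \<phi>] D_closed sa_in_D complex_eq_iff)
qed

lemma pos_elem_of_characters:
  assumes "x \<in> sa" "\<And>\<phi>. \<phi> \<in> characters D \<Longrightarrow> 0 < Re (\<phi> x)"
  shows "pos_elem x"
  using character_of_not_pos[OF assms(1)] assms(2) by (metis not_less)

text \<open>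
  For self-adjoint \<open>y\<close> the characters show that \<open>s + e/2 - y\<close> and \<open>s + e/2 + y\<close> are positive,
  which bounds the norm of \<open>y\<close>. The general case is this one for \<open>x\<^sup>\<star> x\<close>.
\<close>

lemma norm_le_of_characters:
  assumes x: "x \<in> D" and t: "0 \<le> t" and le: "\<And>\<phi>. \<phi> \<in> characters D \<Longrightarrow> cmod (\<phi> x) \<le> t"
  shows "norm x \<le> t"
proof -
  have sa: "norm y \<le> s" if y: "y \<in> sa" and s: "0 \<le> s" 
    and le: "\<And>\<phi>. \<phi> \<in> characters D \<Longrightarrow> cmod (\<phi> y) \<le> s" for y s
  proof (rule field_le_epsilon)
    fix e :: real assume e: "e > 0"
    have "pos_elem (of_real (s + e/2) - y)" "pos_elem (of_real (s + e/2) + y)"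
      using y e le abs_Re_le_cmod 
      by (intro pos_elem_of_characters; 
          simp add: sa_closed character_diff character_add D_closed sa_in_D character_of_real del: of_real_add of_real_divide; 
          smt (verit) half_gt_zero_iff)+
    from norm_le_of_pos[OF y this, of "e/2"] show "norm y \<le> s + e" using e s by simp
  qed
  have "norm (x\<^sup>\<star> * x) \<le> t * t"
  proof (rule sa)
    show "x\<^sup>\<star> * x \<in> sa" using x by (simp add: sa_def D_closed star_mult)
    show "cmod (\<phi> (x\<^sup>\<star> * x)) \<le> t * t" if "\<phi> \<in> characters D" for \<phi>
      using le[OF that] t x that
      by (simp add: character_mult character_star D_closed norm_mult mult_mono)
  qed (use t in simp)
  then have "(norm x)\<^sup>2 \<le> t\<^sup>2" by (simp add: cstar_identity power2_eq_square)
  then show ?thesis using t by (rule power2_le_imp_le)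
qed

lemma characters_eqI:
  assumes "x \<in> D" "y \<in> D" "\<And>\<phi>. \<phi> \<in> characters D \<Longrightarrow> \<phi> x = \<phi> y"
  shows "x = y"
  using norm_le_of_characters[of "x - y" 0] assms by (simp add: D_closed character_diff)

lemma saI_of_characters:
  assumes "x \<in> D" "\<And>\<phi>. \<phi> \<in> characters D \<Longrightarrow> Im (\<phi> x) = 0"
  shows "x \<in> sa"
  using characters_eqI[of "x\<^sup>\<star>" x] assms by (simp add: sa_def D_closed character_star complex_eq_iff)

end

text \<open>
  Separation properties pass from the values to functions because distinct functions differ in some
  coordinate. The Hausdorff property lets the Stone-Weierstrass theorem apply to sets of characters;
  the two weaker properties are its superclasses.
\<close>

lemma open_vimage_coordinate: "open U \<Longrightarrow> open ((\<lambda>h::'a \<Rightarrow> 'b::topological_space. h i) -` U)"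
  by (rule open_vimage) (auto intro: continuous_on_product_coordinates)

instance "fun" :: (type, t0_space) t0_space
proof
  fix f g :: "'a \<Rightarrow> 'b" assume "f \<noteq> g"
  then obtain i where i: "f i \<noteq> g i" by blast
  then obtain U where "open U" "(f i \<in> U) \<noteq> (g i \<in> U)"
    using i separation_t0 by metis
  then show "\<exists>U. open U \<and> \<not> (f \<in> U \<longleftrightarrow> g \<in> U)"
    by (intro exI[of _ "(\<lambda>h. h i) -` U"]) (auto intro: open_vimage_coordinate)
qed

instance "fun" :: (type, t1_space) t1_space
proof
  fix f g :: "'a \<Rightarrow> 'b" assume "f \<noteq> g"
  then obtain i where i: "f i \<noteq> g i" by blast
  then obtain U where "open U" "f i \<in> U" "g i \<notin> U"
    using i separation_t1 by metis
  then show "\<exists>U. open U \<and> f \<in> U \<and> g \<notin> U"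
    by (intro exI[of _ "(\<lambda>h. h i) -` U"]) (auto intro: open_vimage_coordinate)
qed

instance "fun" :: (type, t2_space) t2_space
proof
  fix f g :: "'a \<Rightarrow> 'b" assume "f \<noteq> g"
  then obtain i where i: "f i \<noteq> g i" by blast
  then obtain U V where "open U" "open V" "f i \<in> U" "g i \<in> V" "U \<inter> V = {}"
    using hausdorff[OF i] by blast
  then show "\<exists>U V. open U \<and> open V \<and> f \<in> U \<and> g \<in> V \<and> U \<inter> V = {}"
    by (intro exI[of _ "(\<lambda>h. h i) -` U"] exI[of _ "(\<lambda>h. h i) -` V"]) (auto intro: open_vimage_coordinate)
qed

context abelian_cstar
begin

text \<open>
  Characters are undefined off \<open>D\<close>, so the coordinates outside \<open>D\<close> are constant and pointwise
  convergence on \<open>D\<close> is the same as pointwise convergence everywhere.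
\<close>

lemma character_space_eq: "character_space D = top_of_set (characters D)"
proof -
  have ext: "characters D \<subseteq> extensional D" by (auto simp: characters_def)
  have top: "topspace (character_space D) = characters D"
    using ext by (auto simp: character_space_def PiE_def)
  have "continuous_map (character_space D) euclidean (\<lambda>\<phi>. \<phi> x)" for x
  proof (cases "x \<in> D")
    case True
    then show ?thesis
      unfolding character_space_def
      by (intro continuous_map_from_subtopology continuous_map_product_projection)
  next
    case False
    have "continuous_map (character_space D) euclidean (\<lambda>\<phi>. undefined :: complex)"
      by simp
    then show ?thesis
      by (rule continuous_map_eq) (use False ext top in \<open>auto simp: extensional_def\<close>)
  qed
  then have "continuous_map (character_space D) euclidean id"
    unfolding euclidean_product_topology[symmetric] continuous_map_componentwise_UNIV by simp
  moreover have "continuous_map (top_of_set (characters D)) (product_topology (\<lambda>_. euclidean) D) id"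
    unfolding continuous_map_componentwise using ext
    by (auto intro: continuous_on_product_coordinates continuous_on_subset)
  ultimately have "homeomorphic_maps (character_space D) (top_of_set (characters D)) id id"
    using top by (auto simp: homeomorphic_maps_def continuous_map_in_subtopology character_space_def)
  then show ?thesis by (simp add: homeomorphic_maps_id)
qed

text \<open>
  The characters are a closed subset of a product of discs. Nonvanishing is not a closed condition;
  it is replaced by the equivalent \<open>\<phi> 1 = 1\<close>.
\<close>

lemma compact_characters: "compact (characters D)"
proof -
  let ?B = "\<lambda>x. if x \<in> D then cball (0::complex) (norm x) else {undefined}"
  have "compactin (product_topology (\<lambda>_. euclidean) UNIV) (PiE UNIV ?B)"
    by (auto simp: compactin_PiE)
  then have comp: "compact (PiE UNIV ?B)"
    by (simp add: euclidean_product_topology)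
  let ?M = "{\<phi>. (\<forall>x\<in>D. \<forall>y\<in>D. \<phi> (x + y) = \<phi> x + \<phi> y) \<and>
     (\<forall>c. \<forall>x\<in>D. \<phi> (c *\<^sub>C x) = c * \<phi> x) \<and>
     (\<forall>x\<in>D. \<forall>y\<in>D. \<phi> (x * y) = \<phi> x * \<phi> y) \<and> \<phi> 1 = 1}"
  have "closed ?M"
    unfolding Ball_def
    by (intro closed_Collect_conj closed_Collect_all closed_Collect_imp closed_Collect_eq open_Collect_const
        continuous_intros continuous_on_product_coordinates)
  moreover have "characters D = PiE UNIV ?B \<inter> ?M"
  proof
    show "characters D \<subseteq> PiE UNIV ?B \<inter> ?M"
    proof
      fix \<phi> assume \<phi>: "\<phi> \<in> characters D"
      then have "\<phi> \<in> extensional D" by (simp add: characters_def)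
      then have "\<phi> \<in> PiE UNIV ?B" using character_bound[OF \<phi>] by (auto simp: extensional_def)
      then show "\<phi> \<in> PiE UNIV ?B \<inter> ?M"
        using character_add[OF \<phi>] character_scaleC[OF \<phi>] character_mult[OF \<phi>] character_one[OF \<phi>] by simp
    qed
    have "\<exists>x\<in>D. \<phi> x \<noteq> 0" if "\<phi> 1 = 1" for \<phi> :: "'a \<Rightarrow> complex"
      using that one_in by (intro bexI[of _ 1]) auto
    then show "PiE UNIV ?B \<inter> ?M \<subseteq> characters D"
      by (auto simp: characters_def extensional_def PiE_iff split: if_splits)
  qed
  ultimately show ?thesis using comp by (simp add: compact_Int_closed)
qed

text \<open>
  By Stone-Weierstrass the transforms of self-adjoint elements are dense in the real continuous
  functions. As the transform is isometric and \<open>sa\<close> is closed, they are all of them.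
\<close>

lemma gelfand_surj_real:
  fixes f :: "('a \<Rightarrow> complex) \<Rightarrow> real"
  assumes f: "continuous_on (characters D) f"
  obtains a where "a \<in> sa" "\<And>\<phi>. \<phi> \<in> characters D \<Longrightarrow> \<phi> a = of_real (f \<phi>)"
proof -
  let ?R = "{g. \<exists>a\<in>sa. \<forall>\<phi>\<in>characters D. g \<phi> = Re (\<phi> a)}"
  interpret function_ring_on ?R "characters D"
  proof
    show "compact (characters D)" by (rule compact_characters)
    show "continuous_on (characters D) g" if "g \<in> ?R" for g
    proof -
      obtain a where "\<forall>\<phi>\<in>characters D. g \<phi> = Re (\<phi> a)" using \<open>g \<in> ?R\<close> by blast
      moreover have "continuous_on (characters D) (\<lambda>\<phi>. Re (\<phi> a))"
        by (intro continuous_intros continuous_on_subset[OF continuous_on_product_coordinates]) auto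
      ultimately show ?thesis by (simp cong: continuous_on_cong)
    qed
    fix g h assume "g \<in> ?R" "h \<in> ?R"
    then obtain a b where ab: "a \<in> sa" "b \<in> sa" "\<forall>\<phi>\<in>characters D. g \<phi> = Re (\<phi> a)"
      "\<forall>\<phi>\<in>characters D. h \<phi> = Re (\<phi> b)" by blast
    show "(\<lambda>x. g x + h x) \<in> ?R"
      using ab by (auto intro!: bexI[of _ "a + b"] simp: character_add sa_in_D sa_closed)
    show "(\<lambda>x. g x * h x) \<in> ?R"
      using ab by (auto intro!: bexI[of _ "a * b"] simp: character_mult sa_in_D sa_closed character_sa_real)
  next
    show "(\<lambda>_. c) \<in> ?R" for c
      by (auto intro!: bexI[of _ "of_real c"] simp: character_of_real sa_closed)
    fix \<phi> \<psi> assume *: "\<phi> \<in> characters D" "\<psi> \<in> characters D" "\<phi> \<noteq> \<psi>"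
    then obtain x where x: "x \<in> D" "\<phi> x \<noteq> \<psi> x"
      by (metis (mono_tags, lifting) characters_def extensionalityI mem_Collect_eq)
    then obtain a where "a \<in> sa" "\<phi> a \<noteq> \<psi> a"
      using character_decomp[OF *(1) x(1)] character_decomp[OF *(2) x(1)] re_part_sa[OF x(1)] im_part_sa[OF x(1)]
      by metis
    then show "\<exists>g\<in>?R. g \<phi> \<noteq> g \<psi>"
      using * character_sa_real by (intro bexI[of _ "\<lambda>\<phi>. Re (\<phi> a)"]) (auto simp: complex_eq_iff)
  qed
  have "\<exists>a\<in>sa. \<forall>\<phi>\<in>characters D. \<bar>f \<phi> - Re (\<phi> a)\<bar> < 1 / Suc n" for n
    using Stone_Weierstrass_basic[OF f, of "1 / Suc n"] by fastforce
  then obtain a where a: "\<And>n. a n \<in> sa"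
    "\<And>n \<phi>. \<phi> \<in> characters D \<Longrightarrow> \<bar>f \<phi> - Re (\<phi> (a n))\<bar> < 1 / Suc n" by metis
  have dist: "norm (a n - a m) \<le> 1 / Suc n + 1 / Suc m" for n m
  proof (rule norm_le_of_characters)
    fix \<phi> assume \<phi>: "\<phi> \<in> characters D"
    have "cmod (\<phi> (a n - a m)) = \<bar>Re (\<phi> (a n)) - Re (\<phi> (a m))\<bar>"
      using a(1) by (simp add: character_diff[OF \<phi>] sa_in_D character_sa_real[OF \<phi>] cmod_def)
    then show "cmod (\<phi> (a n - a m)) \<le> 1 / Suc n + 1 / Suc m"
      using a(2)[OF \<phi>, of n] a(2)[OF \<phi>, of m] by linarith
  qed (use a in \<open>auto simp: D_closed sa_in_D\<close>)
  have "Cauchy a"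
  proof (rule metric_CauchyI)
    fix e :: real assume "e > 0"
    then obtain N where N: "1 / Suc N < e / 2" using nat_approx_posE[of "e/2"] by auto
    have "dist (a m) (a n) < e" if "m \<ge> N" "n \<ge> N" for m n
    proof -
      have "1 / Suc m \<le> 1 / Suc N" "1 / Suc n \<le> 1 / Suc N"
        using that by (simp_all add: divide_simps)
      then show ?thesis using dist[of m n] N by (simp add: dist_norm)
    qed
    then show "\<exists>M. \<forall>m\<ge>M. \<forall>n\<ge>M. dist (a m) (a n) < e" by blast
  qed
  then obtain l where l: "a \<longlonglongrightarrow> l" using Cauchy_convergent convergent_def by blast
  have lsa: "l \<in> sa" using closed_sequentially[OF closed_sa _ l] a by blast
  have "\<phi> l = of_real (f \<phi>)" if \<phi>: "\<phi> \<in> characters D" for \<phi>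
  proof -
    have "(\<lambda>n. \<phi> (a n) - \<phi> l) \<longlonglongrightarrow> 0"
    proof (rule Lim_null_comparison)
      show "\<forall>\<^sub>F n in sequentially. cmod (\<phi> (a n) - \<phi> l) \<le> norm (a n - l)"
        using character_bound[OF \<phi>, of "a _ - l"] a lsa 
        by (intro always_eventually) (simp add: character_diff[OF \<phi>] sa_in_D D_closed)
      show "(\<lambda>n. norm (a n - l)) \<longlonglongrightarrow> 0"
        using l by (simp add: LIM_zero tendsto_norm_zero)
    qed
    then have 1: "(\<lambda>n. \<phi> (a n)) \<longlonglongrightarrow> \<phi> l" by (rule LIM_zero_cancel)
    have "(\<lambda>n. \<phi> (a n) - of_real (f \<phi>)) \<longlonglongrightarrow> 0"
    proof (rule Lim_null_comparison)
      show "\<forall>\<^sub>F n in sequentially. cmod (\<phi> (a n) - of_real (f \<phi>)) \<le> 1 / Suc n"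
        using a(2)[OF \<phi>] character_sa_real[OF \<phi> a(1)]
        by (intro always_eventually) (simp add: cmod_def abs_minus_commute less_imp_le)
      show "(\<lambda>n. 1 / real (Suc n)) \<longlonglongrightarrow> 0" by (rule LIMSEQ_Suc[OF lim_1_over_n])
    qed
    then have "(\<lambda>n. \<phi> (a n)) \<longlonglongrightarrow> of_real (f \<phi>)" by (rule LIM_zero_cancel)
    with 1 show ?thesis by (rule LIMSEQ_unique)
  qed
  with lsa show ?thesis using that by blast
qed

lemma gelfand_surj:
  fixes f :: "('a \<Rightarrow> complex) \<Rightarrow> complex"
  assumes f: "continuous_on (characters D) f"
  obtains a where "a \<in> D" "\<And>\<phi>. \<phi> \<in> characters D \<Longrightarrow> \<phi> a = f \<phi>"
proof -
  obtain h where h: "h \<in> sa" "\<And>\<phi>. \<phi> \<in> characters D \<Longrightarrow> \<phi> h = of_real (Re (f \<phi>))"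
    using gelfand_surj_real[of "\<lambda>\<phi>. Re (f \<phi>)"] f continuous_on_Re by blast
  obtain k where k: "k \<in> sa" "\<And>\<phi>. \<phi> \<in> characters D \<Longrightarrow> \<phi> k = of_real (Im (f \<phi>))"
    using gelfand_surj_real[of "\<lambda>\<phi>. Im (f \<phi>)"] f continuous_on_Im by blast
  show ?thesis
    by (rule that[of "h + \<i> *\<^sub>C k"])
      (use h k in \<open>simp_all add: D_closed sa_in_D character_add character_scaleC complex_eq_iff\<close>)
qed

lemma functional_calculus:
  assumes x: "x \<in> D" and F: "continuous_on UNIV F"
  obtains y where "y \<in> D" "\<And>\<phi>. \<phi> \<in> characters D \<Longrightarrow> \<phi> y = F (\<phi> x)"
proof -
  have "continuous_on (characters D) (\<lambda>\<phi>. F (\<phi> x))"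
    by (rule continuous_on_compose2[OF F]) (auto intro: continuous_on_subset[OF continuous_on_product_coordinates])
  then show ?thesis using gelfand_surj that by blast
qed

lemma real_functional_calculus:
  fixes f :: "complex \<Rightarrow> real"
  assumes x: "x \<in> D" and f: "continuous_on UNIV f"
  obtains y where "y \<in> sa" "\<And>\<phi>. \<phi> \<in> characters D \<Longrightarrow> \<phi> y = of_real (f (\<phi> x))"
proof -
  have "continuous_on UNIV (\<lambda>z. complex_of_real (f z))" using f by (intro continuous_intros)
  from functional_calculus[OF x this] obtain y
    where y: "y \<in> D" "\<And>\<phi>. \<phi> \<in> characters D \<Longrightarrow> \<phi> y = of_real (f (\<phi> x))" by blast
  have "y \<in> sa"
  proof (rule saI_of_characters[OF y(1)])
    show "Im (\<phi> y) = 0" if "\<phi> \<in> characters D" for \<phi> using y(2)[OF that] by simp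
  qed
  with y that show ?thesis by blast
qed

end

section \<open>Normalizers and their partial homeomorphisms\<close>

lemma normalizers_star: "v \<in> normalizers D \<Longrightarrow> v\<^sup>\<star> \<in> normalizers D"
  by (auto simp: normalizers_def)

context abelian_cstar
begin

lemma normalizer_conj: "v \<in> normalizers D \<Longrightarrow> d \<in> D \<Longrightarrow> v * d * v\<^sup>\<star> \<in> D"
  and normalizer_star_conj: "v \<in> normalizers D \<Longrightarrow> d \<in> D \<Longrightarrow> v\<^sup>\<star> * d * v \<in> D"
  by (auto simp: normalizers_def)

lemma normalizer_sa:
  assumes "v \<in> normalizers D"
  shows "v\<^sup>\<star> * v \<in> sa" "v * v\<^sup>\<star> \<in> sa"
  using normalizer_conj[OF assms one_in] normalizer_star_conj[OF assms one_in] by (simp_all add: sa_def star_mult)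

lemmas normalizer_in_D = normalizer_sa[THEN sa_in_D]

text \<open>
  The point is multiplicativity, which comes from
  \<open>(v\<^sup>\<star> x v) (v\<^sup>\<star> y v) = v\<^sup>\<star> x (v v\<^sup>\<star>) y v = (v\<^sup>\<star> x y v) (v\<^sup>\<star> v)\<close>. Only \<open>\<phi> (v\<^sup>\<star> v) \<noteq> 0\<close> is
  assumed, so that the lemma is available before \<open>v\<^sup>\<star> v\<close> is known to be positive.
\<close>

lemma beta_character:
  assumes v: "v \<in> normalizers D" and \<phi>: "\<phi> \<in> characters D" and nz: "\<phi> (v\<^sup>\<star> * v) \<noteq> 0"
  shows "beta D v \<phi> \<in> characters D"
  unfolding characters_def
proof (intro CollectI conjI ballI allI)
  show "beta D v \<phi> \<in> extensional D" by (simp add: beta_def)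
  fix x y assume xy: "x \<in> D" "y \<in> D"
  note n = normalizer_star_conj[OF v]
  have "v\<^sup>\<star> * (x + y) * v = v\<^sup>\<star> * x * v + v\<^sup>\<star> * y * v" by (simp add: ring_distribs)
  then show "beta D v \<phi> (x + y) = beta D v \<phi> x + beta D v \<phi> y"
    using xy by (simp add: beta_def D_closed character_add[OF \<phi>] n add_divide_distrib)
  have "(v\<^sup>\<star> * x * v) * (v\<^sup>\<star> * y * v) = v\<^sup>\<star> * x * ((v * v\<^sup>\<star>) * y) * v"
    by (simp add: mult.assoc)
  also have "\<dots> = v\<^sup>\<star> * x * (y * (v * v\<^sup>\<star>)) * v"
    using xy normalizer_in_D[OF v] by (simp add: comm)
  also have "\<dots> = (v\<^sup>\<star> * (x * y) * v) * (v\<^sup>\<star> * v)"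
    by (simp add: mult.assoc)
  finally have "\<phi> (v\<^sup>\<star> * x * v) * \<phi> (v\<^sup>\<star> * y * v) = \<phi> (v\<^sup>\<star> * (x * y) * v) * \<phi> (v\<^sup>\<star> * v)"
    using xy normalizer_in_D[OF v] n by (simp add: D_closed flip: character_mult[OF \<phi>])
  then show "beta D v \<phi> (x * y) = beta D v \<phi> x * beta D v \<phi> y"
    using xy nz by (simp add: beta_def D_closed divide_simps)
next
  fix c x assume x: "x \<in> D"
  have "v\<^sup>\<star> * (c *\<^sub>C x) * v = c *\<^sub>C (v\<^sup>\<star> * x * v)" by (simp add: mult_scaleC_left mult_scaleC_right)
  then show "beta D v \<phi> (c *\<^sub>C x) = c * beta D v \<phi> x"
    using x by (simp add: beta_def D_closed character_scaleC[OF \<phi>] normalizer_star_conj[OF v])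
next
  show "\<exists>x\<in>D. beta D v \<phi> x \<noteq> 0"
    using nz one_in by (intro bexI[of _ 1]) (simp_all add: beta_def)
qed

lemma beta_range_projection:
  assumes v: "v \<in> normalizers D" and \<phi>: "\<phi> \<in> characters D" and nz: "\<phi> (v\<^sup>\<star> * v) \<noteq> 0"
  shows "beta D v \<phi> (v * v\<^sup>\<star>) = \<phi> (v\<^sup>\<star> * v)"
proof -
  have "v\<^sup>\<star> * (v * v\<^sup>\<star>) * v = (v\<^sup>\<star> * v) * (v\<^sup>\<star> * v)" by (simp add: mult.assoc)
  then show ?thesis
    using nz normalizer_in_D[OF v] by (simp add: beta_def character_mult[OF \<phi>])
qed

lemma beta_inverse:
  assumes v: "v \<in> normalizers D" and \<phi>: "\<phi> \<in> characters D" and nz: "\<phi> (v\<^sup>\<star> * v) \<noteq> 0"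
  shows "beta D (v\<^sup>\<star>) (beta D v \<phi>) = \<phi>"
proof (rule extensionalityI)
  show "beta D (v\<^sup>\<star>) (beta D v \<phi>) \<in> extensional D" by (simp add: beta_def)
  show "\<phi> \<in> extensional D" using \<phi> by (simp add: characters_def)
  fix d assume d: "d \<in> D"
  have "v\<^sup>\<star> * (v * d * v\<^sup>\<star>) * v = (v\<^sup>\<star> * v) * d * (v\<^sup>\<star> * v)" by (simp add: mult.assoc)
  then have "beta D v \<phi> (v * d * v\<^sup>\<star>) = \<phi> (v\<^sup>\<star> * v) * \<phi> d"
    using nz d normalizer_in_D[OF v] normalizer_conj[OF v d] by (simp add: beta_def character_mult[OF \<phi>] D_closed)
  then show "beta D (v\<^sup>\<star>) (beta D v \<phi>) d = \<phi> d"
    using nz d beta_range_projection[OF assms] by (simp add: beta_def[of D "v\<^sup>\<star>"])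
qed

lemma character_pos_elem:
  assumes \<phi>: "\<phi> \<in> characters D" and x: "x \<in> D" "pos_elem x"
  shows "0 \<le> Re (\<phi> x)"
proof -
  obtain t where t: "norm (of_real t - x) \<le> t" using x by (auto simp: pos_elem_def)
  have "cmod (of_real t - \<phi> x) \<le> t"
    using character_bound[OF \<phi>, of "of_real t - x"] t x by (simp add: character_diff[OF \<phi>] character_of_real[OF \<phi>] D_closed)
  then show ?thesis using abs_Re_le_cmod[of "of_real t - \<phi> x"] by simp
qed

lemma normalizer_mult:
  assumes v: "v \<in> normalizers D" and b: "b \<in> D"
  shows "v * b \<in> normalizers D"
proof -
  have eq: "(v * b) * d * (v * b)\<^sup>\<star> = v * (b * d * b\<^sup>\<star>) * v\<^sup>\<star>"
    "(v * b)\<^sup>\<star> * d * (v * b) = b\<^sup>\<star> * (v\<^sup>\<star> * d * v) * b" for d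
    by (simp_all add: star_mult mult.assoc)
  have "(v * b) * d * (v * b)\<^sup>\<star> \<in> D" "(v * b)\<^sup>\<star> * d * (v * b) \<in> D" if "d \<in> D" for d
    unfolding eq using that b normalizer_conj[OF v] normalizer_star_conj[OF v] by (simp_all only: D_closed)
  then show ?thesis unfolding normalizers_def by blast
qed

text \<open>
  Kaplansky's argument, transported to characters. Let \<open>b\<close> be the negative part of \<open>a = v\<^sup>\<star> v\<close> and
  \<open>x = v b\<close>. Then \<open>x\<^sup>\<star> x = b a b = - b\<^sup>3\<close> is nonpositive. The value of \<open>x x\<^sup>\<star>\<close> at a character, if
  not \<open>0\<close>, is the value of \<open>x\<^sup>\<star> x\<close> at its image under \<open>beta D (x\<^sup>\<star>)\<close>, so \<open>x x\<^sup>\<star>\<close> is nonpositive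
  too. But the sum of both is twice a sum of squares. Hence \<open>b\<close> vanishes at \<open>\<phi>\<close>.
\<close>

lemma normalizer_nonneg:
  assumes v: "v \<in> normalizers D" and \<phi>: "\<phi> \<in> characters D"
  shows "0 \<le> Re (\<phi> (v\<^sup>\<star> * v))"
proof -
  define a where "a = v\<^sup>\<star> * v"
  have a: "a \<in> sa" using normalizer_sa[OF v] by (simp add: a_def)
  have "continuous_on UNIV (\<lambda>z. max 0 (- Re z))" by (intro continuous_intros)
  from real_functional_calculus[OF sa_in_D[OF a] this] obtain b where
    "b \<in> sa" and val_b: "\<And>\<phi>. \<phi> \<in> characters D \<Longrightarrow> \<phi> b = of_real (max 0 (- Re (\<phi> a)))" by blast
  then have b: "b \<in> D" and bs: "b\<^sup>\<star> = b" by (simp_all add: sa_def)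
  define x where "x = v * b"
  have x: "x \<in> normalizers D" unfolding x_def by (rule normalizer_mult[OF v b])
  have xx: "x\<^sup>\<star> * x = b * a * b" by (simp add: x_def a_def star_mult bs mult.assoc)
  have val: "Re (\<psi> (x\<^sup>\<star> * x)) = - (max 0 (- Re (\<psi> a)) ^ 3)" if \<psi>: "\<psi> \<in> characters D" for \<psi>
  proof -
    have "\<psi> (x\<^sup>\<star> * x) = of_real (max 0 (- Re (\<psi> a)) * Re (\<psi> a) * max 0 (- Re (\<psi> a)))"
      using a b val_b[OF \<psi>] character_sa[OF \<psi> a] by (simp add: xx character_mult[OF \<psi>] D_closed sa_in_D)
    then show ?thesis by (simp add: max_def power3_eq_cube)
  qed
  have neg1: "Re (\<phi> (x\<^sup>\<star> * x)) \<le> 0" using val[OF \<phi>] by simp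
  have neg2: "Re (\<phi> (x * x\<^sup>\<star>)) \<le> 0"
  proof (cases "\<phi> (x * x\<^sup>\<star>) = 0")
    case False
    note xs = normalizers_star[OF x]
    have nz: "\<phi> ((x\<^sup>\<star>)\<^sup>\<star> * x\<^sup>\<star>) \<noteq> 0" using False by simp
    have "beta D (x\<^sup>\<star>) \<phi> (x\<^sup>\<star> * x) = \<phi> (x * x\<^sup>\<star>)"
      using beta_range_projection[OF xs \<phi> nz] by simp
    then show ?thesis
      using val[OF beta_character[OF xs \<phi> nz]] by simp
  qed simp
  have "pos_elem (x\<^sup>\<star> * x + x * x\<^sup>\<star>)"
    unfolding star_mult_self_plus by (intro pos_elem_scaleR pos_elem_add pos_elem_square) auto
  then have "0 \<le> Re (\<phi> (x\<^sup>\<star> * x + x * x\<^sup>\<star>))"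
    using normalizer_in_D[OF x] by (intro character_pos_elem[OF \<phi>]) (auto simp: D_closed)
  then have "Re (\<phi> (x\<^sup>\<star> * x)) = 0"
    using neg1 neg2 normalizer_in_D[OF x] by (simp add: character_add[OF \<phi>])
  then show ?thesis using val[OF \<phi>] by (simp add: a_def max_def split: if_splits)
qed

lemma S_set_iff:
  assumes v: "v \<in> normalizers D"
  shows "\<phi> \<in> S_set D v \<longleftrightarrow> \<phi> \<in> characters D \<and> \<phi> (v\<^sup>\<star> * v) \<noteq> 0"
proof -
  have "\<phi> (v\<^sup>\<star> * v) \<in> \<real> \<and> Re (\<phi> (v\<^sup>\<star> * v)) > 0 \<longleftrightarrow> \<phi> (v\<^sup>\<star> * v) \<noteq> 0" if "\<phi> \<in> characters D"
    using normalizer_nonneg[OF v that] character_sa_real[OF that normalizer_sa(1)[OF v]]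
    by (auto simp: complex_eq_iff complex_is_Real_iff)
  then show ?thesis by (auto simp: S_set_def)
qed

lemma beta_S_set:
  assumes v: "v \<in> normalizers D" and \<phi>: "\<phi> \<in> S_set D v"
  shows "beta D v \<phi> \<in> S_set D (v\<^sup>\<star>)" "beta D (v\<^sup>\<star>) (beta D v \<phi>) = \<phi>"
  using \<phi> beta_character[OF v] beta_inverse[OF v] beta_range_projection[OF v]
  by (simp_all add: S_set_iff v normalizers_star)

section \<open>Intertwiners from extensions to the closures\<close>

lemma topspace_character_space: "topspace (character_space D) = characters D"
  by (simp add: character_space_eq)

lemma normal_character_space: "normal_space (character_space D)"
proof (rule compact_Hausdorff_or_regular_imp_normal_space)
  show "compact_space (character_space D)"
    using compact_characters by (simp add: character_space_eq compact_space_subtopology)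
  have "Hausdorff_space (product_topology (\<lambda>_. euclidean :: complex topology) D)"
    by (simp add: Hausdorff_space_product_topology)
  then show "Hausdorff_space (character_space D) \<or> regular_space (character_space D)"
    by (simp add: character_space_def Hausdorff_space_subtopology)
qed

lemma S_set_subset_closure: "S_set D v \<subseteq> topspace (closure_S D v)"
proof -
  have "S_set D v \<subseteq> topspace (character_space D)"
    by (auto simp: topspace_character_space S_set_def)
  then show ?thesis
    using closure_of_subset[of "S_set D v" "character_space D"] by (simp add: closure_S_def)
qed

lemma continuous_map_evaluation:
  assumes "d \<in> D"
  shows "continuous_map (character_space D) euclidean (\<lambda>\<phi>. \<phi> d)"
  using assms unfolding character_space_def
  by (intro continuous_map_from_subtopology continuous_map_product_projection)

text \<open>
  Tietze's theorem for the real and imaginary parts, followed by surjectivity of the Gelfand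
  transform.
\<close>

lemma gelfand_extension:
  assumes K: "closedin (character_space D) K"
    and f: "continuous_map (subtopology (character_space D) K) euclidean f"
  obtains d where "d \<in> D" "\<And>\<phi>. \<phi> \<in> K \<Longrightarrow> \<phi> d = f \<phi>"
proof -
  have re: "continuous_map (subtopology (character_space D) K) euclideanreal (\<lambda>\<phi>. Re (f \<phi>))"
    using continuous_map_compose[OF f, of euclideanreal Re] by (simp add: o_def continuous_on_Re)
  have im: "continuous_map (subtopology (character_space D) K) euclideanreal (\<lambda>\<phi>. Im (f \<phi>))"
    using continuous_map_compose[OF f, of euclideanreal Im] by (simp add: o_def continuous_on_Im)
  obtain g where g: "continuous_map (character_space D) euclideanreal g" "\<And>\<phi>. \<phi> \<in> K \<Longrightarrow> g \<phi> = Re (f \<phi>)"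
    using Tietze_extension_realinterval[OF normal_character_space K is_interval_univ _ re] by auto
  obtain h where h: "continuous_map (character_space D) euclideanreal h" "\<And>\<phi>. \<phi> \<in> K \<Longrightarrow> h \<phi> = Im (f \<phi>)"
    using Tietze_extension_realinterval[OF normal_character_space K is_interval_univ _ im] by auto
  have "continuous_on (characters D) g" "continuous_on (characters D) h"
    using g h by (simp_all add: character_space_eq)
  then have "continuous_on (characters D) (\<lambda>\<phi>. Complex (g \<phi>) (h \<phi>))"
    unfolding Complex_eq by (intro continuous_intros)
  from gelfand_surj[OF this] obtain d where
    d: "d \<in> D" "\<And>\<phi>. \<phi> \<in> characters D \<Longrightarrow> \<phi> d = Complex (g \<phi>) (h \<phi>)" by blast
  have "K \<subseteq> characters D" using closedin_subset[OF K] by (simp add: topspace_character_space)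
  with d g h that show ?thesis by (metis complex.collapse subsetD)
qed

text \<open>
  Off \<open>S_set D (v\<^sup>\<star>)\<close> nothing is known about \<open>d'\<close>, but there \<open>v v\<^sup>\<star>\<close> vanishes, and so does
  \<open>v d v\<^sup>\<star>\<close>, whose square is a multiple of \<open>v v\<^sup>\<star>\<close>. Therefore \<open>d' v v\<^sup>\<star> = v d v\<^sup>\<star>\<close>, that is,
  \<open>x v\<^sup>\<star> = 0\<close> for \<open>x = v d - d' v\<close>. As \<open>v\<^sup>\<star> v\<close> commutes with \<open>d\<^sup>\<star>\<close>, this kills
  \<open>x d\<^sup>\<star> v\<^sup>\<star> v\<close>, hence \<open>(x x\<^sup>\<star>) (x x\<^sup>\<star>)\<^sup>\<star>\<close>, hence \<open>x\<close>.
\<close>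

lemma intertwines_of_ratio:
  assumes v: "v \<in> normalizers D" and d: "d \<in> D" "d' \<in> D"
    and eq: "\<And>\<phi>. \<phi> \<in> S_set D (v\<^sup>\<star>) \<Longrightarrow> \<phi> d' = beta D (v\<^sup>\<star>) \<phi> d"
  shows "v * d = d' * v"
proof -
  note vs = normalizers_star[OF v]
  have *: "d' * (v * v\<^sup>\<star>) = v * d * v\<^sup>\<star>"
  proof (rule characters_eqI)
    show "d' * (v * v\<^sup>\<star>) \<in> D" "v * d * v\<^sup>\<star> \<in> D"
      using d normalizer_in_D[OF v] normalizer_conj[OF v] by (simp_all add: D_closed)
    fix \<phi> assume \<phi>: "\<phi> \<in> characters D"
    have mult: "\<phi> (d' * (v * v\<^sup>\<star>)) = \<phi> d' * \<phi> (v * v\<^sup>\<star>)"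
      using d normalizer_in_D[OF v] by (simp add: character_mult[OF \<phi>])
    show "\<phi> (d' * (v * v\<^sup>\<star>)) = \<phi> (v * d * v\<^sup>\<star>)"
    proof (cases "\<phi> (v * v\<^sup>\<star>) = 0")
      case True
      have "(v * d * v\<^sup>\<star>) * (v * d * v\<^sup>\<star>) = v * (d * (v\<^sup>\<star> * v)) * d * v\<^sup>\<star>"
        by (simp add: mult.assoc)
      also have "\<dots> = v * ((v\<^sup>\<star> * v) * d) * d * v\<^sup>\<star>"
        using d normalizer_in_D[OF v] by (simp add: comm)
      also have "\<dots> = (v * v\<^sup>\<star>) * (v * (d * d) * v\<^sup>\<star>)"
        by (simp add: mult.assoc)
      finally have "\<phi> ((v * d * v\<^sup>\<star>) * (v * d * v\<^sup>\<star>)) = \<phi> (v * v\<^sup>\<star>) * \<phi> (v * (d * d) * v\<^sup>\<star>)"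
        using d normalizer_in_D[OF v] normalizer_conj[OF v] by (simp only: character_mult[OF \<phi>] D_closed)
      then have "\<phi> (v * d * v\<^sup>\<star>) * \<phi> (v * d * v\<^sup>\<star>) = 0"
        using True character_mult[OF \<phi> normalizer_conj[OF v d(1)] normalizer_conj[OF v d(1)]] by simp
      with True mult show ?thesis by simp
    next
      case False
      then have "\<phi> d' = \<phi> (v * d * v\<^sup>\<star>) / \<phi> (v * v\<^sup>\<star>)"
        using eq[of \<phi>] \<phi> d by (simp add: S_set_iff[OF vs] beta_def)
      with False mult show ?thesis by simp
    qed
  qed
  define x where "x = v * d - d' * v"
  have xv: "x * v\<^sup>\<star> = 0" using * by (simp add: x_def left_diff_distrib mult.assoc)
  have "x * (d\<^sup>\<star> * v\<^sup>\<star> * v) = x * ((v\<^sup>\<star> * v) * d\<^sup>\<star>)"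
    using d normalizer_in_D[OF v] comm[of "d\<^sup>\<star>" "v\<^sup>\<star> * v"] by (simp add: D_closed mult.assoc)
  also have "\<dots> = (x * v\<^sup>\<star>) * v * d\<^sup>\<star>" by (simp add: mult.assoc)
  finally have xd: "x * (d\<^sup>\<star> * v\<^sup>\<star> * v) = 0" using xv by simp
  have "x * x\<^sup>\<star> = x * (d\<^sup>\<star> * v\<^sup>\<star>) - (x * v\<^sup>\<star>) * d'\<^sup>\<star>"
    by (simp add: x_def star_diff star_mult right_diff_distrib mult.assoc)
  then have xx: "x * x\<^sup>\<star> = x * (d\<^sup>\<star> * v\<^sup>\<star>)" using xv by simp
  have "(x * x\<^sup>\<star>)\<^sup>\<star> * (x * x\<^sup>\<star>) = (x * x\<^sup>\<star>) * (x * x\<^sup>\<star>)\<^sup>\<star>" by (simp add: star_mult)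
  also have "\<dots> = (x * (d\<^sup>\<star> * v\<^sup>\<star> * v)) * d * x\<^sup>\<star>"
    unfolding xx by (simp add: star_mult mult.assoc)
  finally have "x * x\<^sup>\<star> = 0" using xd star_mult_self_eq_0 by simp
  then have "x\<^sup>\<star> = 0" using star_mult_self_eq_0[of "x\<^sup>\<star>"] by simp
  then have "x = 0" using norm_star[of x] by simp
  then show ?thesis by (simp add: x_def)
qed

lemma extension_intertwines:
  assumes v: "v \<in> normalizers D" and ext: "beta_extends D (v\<^sup>\<star>)" and d: "d \<in> D"
  obtains d' where "d' \<in> D" "v * d = d' * v"
proof -
  obtain h where h: "homeomorphic_map (closure_S D (v\<^sup>\<star>)) (closure_S D v) h"
    and hb: "\<And>\<phi>. \<phi> \<in> S_set D (v\<^sup>\<star>) \<Longrightarrow> h \<phi> = beta D (v\<^sup>\<star>) \<phi>"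
    using ext unfolding beta_extends_def by auto
  define K where "K = character_space D closure_of S_set D (v\<^sup>\<star>)"
  have K: "closedin (character_space D) K" by (simp add: K_def)
  have "continuous_map (closure_S D (v\<^sup>\<star>)) (character_space D) h"
    using homeomorphic_imp_continuous_map[OF h] by (simp add: closure_S_def continuous_map_in_subtopology)
  from continuous_map_compose[OF this continuous_map_evaluation[OF d]]
  have "continuous_map (subtopology (character_space D) K) euclidean (\<lambda>\<phi>. h \<phi> d)"
    by (simp add: closure_S_def K_def o_def)
  from gelfand_extension[OF K this] obtain d' where d': "d' \<in> D" "\<And>\<phi>. \<phi> \<in> K \<Longrightarrow> \<phi> d' = h \<phi> d" by blast
  have "\<phi> d' = beta D (v\<^sup>\<star>) \<phi> d" if "\<phi> \<in> S_set D (v\<^sup>\<star>)" for \<phi>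
    using d'(2)[of \<phi>] S_set_subset_closure[of "v\<^sup>\<star>"] that hb[OF that] 
    by (auto simp: closure_S_def K_def)
  from intertwines_of_ratio[OF v d d'(1) this] d' that show ?thesis by blast
qed

text \<open>
  The inverse of a homeomorphism extending \<open>beta D (v\<^sup>\<star>)\<close> extends the inverse \<open>beta D v\<close>.
\<close>

lemma beta_extends_star:
  assumes v: "v \<in> normalizers D" and ext: "beta_extends D (v\<^sup>\<star>)"
  shows "beta_extends D v"
proof -
  obtain h where h: "homeomorphic_map (closure_S D (v\<^sup>\<star>)) (closure_S D v) h"
    and hb: "\<And>\<phi>. \<phi> \<in> S_set D (v\<^sup>\<star>) \<Longrightarrow> h \<phi> = beta D (v\<^sup>\<star>) \<phi>"
    using ext unfolding beta_extends_def by auto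
  obtain g where hg: "homeomorphic_maps (closure_S D (v\<^sup>\<star>)) (closure_S D v) h g"
    using h homeomorphic_map_maps by blast
  have "g \<phi> = beta D v \<phi>" if \<phi>: "\<phi> \<in> S_set D v" for \<phi>
  proof -
    have "h (beta D v \<phi>) = \<phi>" using hb beta_S_set[OF v \<phi>] by simp
    moreover have "g (h (beta D v \<phi>)) = beta D v \<phi>"
      using hg beta_S_set(1)[OF v \<phi>] S_set_subset_closure[of "v\<^sup>\<star>"] by (auto simp: homeomorphic_maps_def)
    ultimately show ?thesis by simp
  qed
  moreover have "homeomorphic_map (closure_S D v) (closure_S D (v\<^sup>\<star>)) g"
    using hg homeomorphic_maps_sym homeomorphic_maps_map by blast
  ultimately show ?thesis unfolding beta_extends_def by auto
qed

lemma intertwiner_of_extension: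
  assumes v: "v \<in> normalizers D" and ext: "beta_extends D (v\<^sup>\<star>)"
  shows "(\<lambda>d. v * d) ` D = (\<lambda>d. d * v) ` D"
proof
  show "(\<lambda>d. v * d) ` D \<subseteq> (\<lambda>d. d * v) ` D"
    using extension_intertwines[OF v ext] by (metis (no_types, lifting) image_iff image_subsetI)
  have ext': "beta_extends D ((v\<^sup>\<star>)\<^sup>\<star>)" using beta_extends_star[OF v ext] by simp
  show "(\<lambda>d. d * v) ` D \<subseteq> (\<lambda>d. v * d) ` D"
  proof clarify
    fix d assume "d \<in> D"
    then obtain d' where "d' \<in> D" "v\<^sup>\<star> * d\<^sup>\<star> = d' * v\<^sup>\<star>"
      using extension_intertwines[OF normalizers_star[OF v] ext' star_in] by blast
    then have "d * v = v * d'\<^sup>\<star>" "d'\<^sup>\<star> \<in> D"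
      by (metis star_mult star_star, simp add: D_closed)
    then show "d * v \<in> (\<lambda>d. v * d) ` D" by blast
  qed
qed

section \<open>Approximation of normalizers by intertwiners\<close>

text \<open>
  The element \<open>k\<close> inverts \<open>v\<^sup>\<star> v\<close> on the support of \<open>g\<close>. The witnesses are \<open>v d k v\<^sup>\<star>\<close> and
  \<open>k v\<^sup>\<star> d v\<close>, which lie in \<open>D\<close> because \<open>v\<close> is a normalizer.
\<close>

lemma truncation_intertwines:
  assumes v: "v \<in> normalizers D" and g: "g \<in> D" and k: "k \<in> D" and kg: "k * (v\<^sup>\<star> * v) * g = g"
  shows "v * g \<in> intertwiners D"
proof -
  define a where "a = v\<^sup>\<star> * v"
  have a: "a \<in> D" using normalizer_in_D[OF v] by (simp add: a_def)
  have "\<exists>d'\<in>D. (v * g) * d = d' * (v * g)" if d: "d \<in> D" for d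
  proof (rule bexI)
    show "v * (d * k) * v\<^sup>\<star> \<in> D" using d k by (intro normalizer_conj[OF v]) (simp add: D_closed)
    have "v * (d * k) * v\<^sup>\<star> * (v * g) = v * d * (k * (v\<^sup>\<star> * v) * g)" by (simp add: mult.assoc)
    then show "(v * g) * d = v * (d * k) * v\<^sup>\<star> * (v * g)"
      using kg d g by (simp add: mult.assoc comm)
  qed
  moreover have "\<exists>d'\<in>D. d * (v * g) = (v * g) * d'" if d: "d \<in> D" for d
  proof (rule bexI)
    show "k * (v\<^sup>\<star> * d * v) \<in> D" using k normalizer_star_conj[OF v d] by (simp add: D_closed)
    have gk: "v * (g * k) * v\<^sup>\<star> \<in> D" using g k by (intro normalizer_conj[OF v]) (simp add: D_closed)
    have "(v * g) * (k * (v\<^sup>\<star> * d * v)) = (v * (g * k) * v\<^sup>\<star>) * d * v" by (simp add: mult.assoc)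
    also have "\<dots> = d * (v * (g * k) * v\<^sup>\<star>) * v" using gk d by (simp add: comm)
    also have "\<dots> = d * v * (g * (k * a))" by (simp add: mult.assoc a_def)
    also have "g * (k * a) = k * a * g" using g k a by (simp add: comm D_closed)
    finally show "d * (v * g) = (v * g) * (k * (v\<^sup>\<star> * d * v))"
      using kg by (simp add: a_def mult.assoc)
  qed
  ultimately show ?thesis unfolding intertwiners_def by (fastforce simp: image_iff)
qed

lemma intertwiner_near_normalizer:
  assumes v: "v \<in> normalizers D" and e: "0 < e"
  obtains w where "w \<in> intertwiners D" "(norm (v - w))\<^sup>2 \<le> e"
proof -
  define a where "a = v\<^sup>\<star> * v"
  have a: "a \<in> sa" using normalizer_sa[OF v] by (simp add: a_def)
  have nz: "max \<bar>r\<bar> e \<noteq> 0" "max (e\<^sup>2) (r\<^sup>2) \<noteq> 0" for r using e by (auto simp: max_def)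
  \<comment> \<open>the cutoff: \<open>1 - e / \<bar>r\<bar>\<close> for \<open>\<bar>r\<bar> \<ge> e\<close>, and \<open>0\<close> below\<close>
  have "continuous_on UNIV (\<lambda>z. max 0 (\<bar>Re z\<bar> - e) / max \<bar>Re z\<bar> e)"
    using nz by (intro continuous_intros) auto
  from real_functional_calculus[OF sa_in_D[OF a] this] obtain g where "g \<in> sa" and
    val_g: "\<And>\<phi>. \<phi> \<in> characters D \<Longrightarrow> \<phi> g = of_real (max 0 (\<bar>Re (\<phi> a)\<bar> - e) / max \<bar>Re (\<phi> a)\<bar> e)" by blast
  then have g: "g \<in> D" and gs: "g\<^sup>\<star> = g" by (simp_all add: sa_def)
  \<comment> \<open>agrees with \<open>1 / r\<close> for \<open>\<bar>r\<bar> \<ge> e\<close>, which covers the support of the cutoff\<close>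
  have "continuous_on UNIV (\<lambda>z. Re z / max (e\<^sup>2) ((Re z)\<^sup>2))"
    using nz by (intro continuous_intros) auto
  from real_functional_calculus[OF sa_in_D[OF a] this] obtain k where "k \<in> sa" and
    val_k: "\<And>\<phi>. \<phi> \<in> characters D \<Longrightarrow> \<phi> k = of_real (Re (\<phi> a) / max (e\<^sup>2) ((Re (\<phi> a))\<^sup>2))" by blast
  then have k: "k \<in> D" by (simp add: sa_def)
  have "k * a * g = g"
  proof (rule characters_eqI)
    fix \<phi> assume \<phi>: "\<phi> \<in> characters D"
    define r where "r = Re (\<phi> a)"
    have ra: "\<phi> a = of_real r" using character_sa[OF \<phi> a] by (simp add: r_def)
    have "r / max (e\<^sup>2) (r\<^sup>2) * r * (max 0 (\<bar>r\<bar> - e) / max \<bar>r\<bar> e) = max 0 (\<bar>r\<bar> - e) / max \<bar>r\<bar> e"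
    proof (cases "\<bar>r\<bar> \<le> e")
      case False
      then have "e\<^sup>2 \<le> r\<^sup>2" "r \<noteq> 0" using e abs_le_square_iff[of e r] by auto
      then show ?thesis by (simp add: max_def power2_eq_square)
    qed simp
    then have "of_real (r / max (e\<^sup>2) (r\<^sup>2) * r * (max 0 (\<bar>r\<bar> - e) / max \<bar>r\<bar> e))
        = (of_real (max 0 (\<bar>r\<bar> - e) / max \<bar>r\<bar> e) :: complex)" by simp
    then show "\<phi> (k * a * g) = \<phi> g"
      using g k a by (simp only: character_mult[OF \<phi>] D_closed sa_in_D ra val_g[OF \<phi>] val_k[OF \<phi>] Re_complex_of_real of_real_mult)
  qed (use a g k in \<open>simp_all add: D_closed sa_in_D\<close>)
  then have w: "v * g \<in> intertwiners D"
    using truncation_intertwines[OF v g k] by (simp add: a_def)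
  have "(v - v * g)\<^sup>\<star> * (v - v * g) = (1 - g) * a * (1 - g)"
    by (simp add: star_diff star_mult gs a_def algebra_simps)
  moreover have "norm ((1 - g) * a * (1 - g)) \<le> e"
  proof (rule norm_le_of_characters)
    fix \<phi> assume \<phi>: "\<phi> \<in> characters D"
    define r where "r = Re (\<phi> a)"
    define s where "s = max 0 (\<bar>r\<bar> - e) / max \<bar>r\<bar> e"
    have ra: "\<phi> a = of_real r" using character_sa[OF \<phi> a] by (simp add: r_def)
    have sg: "\<phi> g = of_real s" using val_g[OF \<phi>] by (simp add: r_def s_def)
    have "\<phi> ((1 - g) * a * (1 - g)) = of_real ((1 - s) * r * (1 - s))"
      using a g by (simp add: character_mult[OF \<phi>] character_diff[OF \<phi>] character_one[OF \<phi>] D_closed sa_in_D ra sg)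
    then have "cmod (\<phi> ((1 - g) * a * (1 - g))) = \<bar>(1 - s) * r * (1 - s)\<bar>"
      by (simp only: norm_of_real)
    also have "\<dots> \<le> e"
    proof (cases "\<bar>r\<bar> \<le> e")
      case False
      then have "1 - s = e / \<bar>r\<bar>" using e by (simp add: s_def max_def field_simps)
      then have "\<bar>(1 - s) * r * (1 - s)\<bar> = e * (e / \<bar>r\<bar>)"
        using e False by (simp add: abs_mult)
      also have "\<dots> \<le> e * 1" using e False by (intro mult_left_mono) (auto simp: divide_simps)
      finally show ?thesis by simp
    qed (simp add: s_def)
    finally show "cmod (\<phi> ((1 - g) * a * (1 - g))) \<le> e" .
  qed (use a g e in \<open>simp_all add: D_closed sa_in_D\<close>)
  ultimately have "(norm (v - v * g))\<^sup>2 \<le> e" by (simp flip: cstar_identity)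
  with w show ?thesis using that by blast
qed

lemma normalizers_subset_closure: "normalizers D \<subseteq> closure (intertwiners D)"
proof
  fix v assume v: "v \<in> normalizers D"
  show "v \<in> closure (intertwiners D)"
    unfolding closure_approachable
  proof (intro allI impI)
    fix e :: real assume e: "e > 0"
    obtain w where "w \<in> intertwiners D" "(norm (v - w))\<^sup>2 \<le> (e/2)\<^sup>2"
      using intertwiner_near_normalizer[OF v, of "(e/2)\<^sup>2"] e by auto
    then have "norm (v - w) \<le> e/2" using e power2_le_imp_le[of "norm (v - w)" "e/2"] by simp
    with \<open>w \<in> intertwiners D\<close> e show "\<exists>w\<in>intertwiners D. dist w v < e"
      by (intro bexI[of _ w]) (auto simp: dist_norm norm_minus_commute)
  qed
qed

section \<open>Intertwiners of a maximal abelian subalgebra\<close>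

lemma power_intertwine: "x * w = w * y \<Longrightarrow> x ^ n * w = w * y ^ n" for x y w :: "'b::monoid_mult"
  by (induction n) (simp_all add: mult.assoc, metis mult.assoc power_commutes)

text \<open>
  The element \<open>p\<close> is supported where the spectrum of \<open>c\<close> is in the open upper half plane. For
  \<open>t > 0\<close> put \<open>c' = (c - \<i> t) / t\<close> and \<open>d' = (d - \<i> t) / t\<close>, so that \<open>c' w = w d'\<close>. As \<open>d\<close> is
  self-adjoint, \<open>d'\<close> has an inverse \<open>r\<close> of norm at most \<open>1\<close>, and
  \<open>p w = p c' ^ n w r ^ n\<close> for every \<open>n\<close>. A point \<open>z\<close> with \<open>\<bar>z\<bar> \<le> R\<close> and \<open>y = Im z > 0\<close> satisfies
  \<open>\<bar>(z - \<i> t) / t\<bar>\<^sup>2 \<le> 1 + (R\<^sup>2 - 2 t y) / t\<^sup>2\<close>. Hence for \<open>n = 2 t\<^sup>2\<close> the transform of \<open>p c' ^ n\<close> is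
  at most \<open>y exp (R\<^sup>2 - 2 t y) \<le> exp (R\<^sup>2) / t\<close>, which tends to \<open>0\<close>.
\<close>

lemma upper_half_plane_annihilates:
  assumes d: "d \<in> sa" and c: "c \<in> D" and wd: "w * d = c * w"
    and p: "p \<in> D" "\<And>\<phi>. \<phi> \<in> characters D \<Longrightarrow> \<phi> p = of_real (max 0 (Im (\<phi> c)))"
  shows "p * w = 0"
proof -
  define R where "R = norm c"
  have bound: "norm (p * w) \<le> exp (R\<^sup>2) * norm w / Suc m" for m
  proof -
    define t :: real where "t = Suc m"
    have t: "t > 0" by (simp add: t_def)
    define N where "N = (Suc m)\<^sup>2"
    have Nt: "real N = t\<^sup>2" by (simp add: N_def t_def)
    define c' where "c' = (1/t) *\<^sub>R (c - (\<i> * of_real t) *\<^sub>C 1)"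
    define d' where "d' = (1/t) *\<^sub>R (d - (\<i> * of_real t) *\<^sub>C 1)"
    have cD: "c' \<in> D" "d' \<in> D" using c d by (auto simp: c'_def d'_def D_closed sa_in_D)
    have inter: "c' * w = w * d'"
      using wd by (simp add: c'_def d'_def left_diff_distrib right_diff_distrib mult_scaleC_left mult_scaleC_right)
    have "of_real (Re z) - \<i> * of_real t \<noteq> 0" for z using t by (simp add: complex_eq_iff)
    then have "continuous_on UNIV (\<lambda>z. of_real t / (of_real (Re z) - \<i> * of_real t))"
      by (intro continuous_intros) auto
    then obtain r where r: "r \<in> D"
      "\<And>\<phi>. \<phi> \<in> characters D \<Longrightarrow> \<phi> r = of_real t / (of_real (Re (\<phi> d)) - \<i> * of_real t)"
      using functional_calculus[OF sa_in_D[OF d]] by blast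
    have dr: "d' * r = 1"
    proof (rule characters_eqI)
      fix \<phi> assume \<phi>: "\<phi> \<in> characters D"
      have "\<phi> d - \<i> * of_real t \<noteq> 0"
        using t character_sa_real[OF \<phi> d] by (simp add: complex_eq_iff)
      moreover have "\<phi> d' = (1/t) * (\<phi> d - \<i> * of_real t)"
        using d by (simp add: d'_def character_scaleR[OF \<phi>] character_diff[OF \<phi>] character_scaleC[OF \<phi>] character_one[OF \<phi>] D_closed sa_in_D)
      moreover have "\<phi> r = of_real t / (\<phi> d - \<i> * of_real t)"
        using r(2)[OF \<phi>] character_sa[OF \<phi> d] by simp
      ultimately show "\<phi> (d' * r) = \<phi> 1"
        using t cD r by (simp add: character_mult[OF \<phi>] character_one[OF \<phi>])
    qed (use cD r in \<open>simp_all add: D_closed\<close>)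
    have "norm r \<le> 1"
    proof (rule norm_le_of_characters)
      fix \<phi> assume \<phi>: "\<phi> \<in> characters D"
      have "t \<le> cmod (of_real (Re (\<phi> d)) - \<i> * of_real t)"
        using abs_Im_le_cmod[of "of_real (Re (\<phi> d)) - \<i> * of_real t"] t by simp
      moreover have "cmod (\<phi> r) = t / cmod (of_real (Re (\<phi> d)) - \<i> * of_real t)"
        using t by (simp add: r(2)[OF \<phi>] norm_divide)
      ultimately show "cmod (\<phi> r) \<le> 1" by (simp add: divide_le_eq_1)
    qed (use r in auto)
    then have rN: "norm (r ^ (2 * N)) \<le> 1"
      using norm_power_ineq[of r "2 * N"] power_le_one[of "norm r" "2 * N"] by simp
    have "d' ^ n * r ^ n = 1" for n
    proof (induction n)
      case (Suc n)
      have "d' ^ Suc n * r ^ Suc n = d' ^ n * (d' * r) * r ^ n"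
        by (simp add: power_commutes mult.assoc) (metis mult.assoc power_commutes)
      with Suc dr show ?case by simp
    qed simp
    then have "w = w * (d' ^ (2 * N) * r ^ (2 * N))" by simp
    also have "\<dots> = c' ^ (2 * N) * w * r ^ (2 * N)"
      using power_intertwine[OF inter, of "2 * N"] by (simp add: mult.assoc)
    finally have "p * w = (p * c' ^ (2 * N)) * w * r ^ (2 * N)" by (metis mult.assoc)
    then have "norm (p * w) \<le> norm (p * c' ^ (2 * N) * w) * norm (r ^ (2 * N))"
      using norm_mult_ineq[of "p * c' ^ (2 * N) * w" "r ^ (2 * N)"] by simp
    also have "\<dots> \<le> norm (p * c' ^ (2 * N)) * norm w * 1"
      using rN by (intro mult_mono norm_mult_ineq) auto
    finally have "norm (p * w) \<le> norm (p * c' ^ (2 * N)) * norm w" by simp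
    moreover have "norm (p * c' ^ (2 * N)) \<le> exp (R\<^sup>2) / t"
    proof (rule norm_le_of_characters)
      fix \<phi> assume \<phi>: "\<phi> \<in> characters D"
      define z where "z = \<phi> c"
      define y where "y = Im z"
      have zR: "cmod z \<le> R" using character_bound[OF \<phi> c] by (simp add: z_def R_def)
      have c': "\<phi> c' = (1/t) * (z - \<i> * of_real t)"
        using c by (simp add: c'_def z_def character_scaleR[OF \<phi>] character_diff[OF \<phi>] character_scaleC[OF \<phi>] character_one[OF \<phi>] D_closed)
      have val: "\<phi> (p * c' ^ (2 * N)) = of_real (max 0 y) * (\<phi> c') ^ (2 * N)"
        using cD p(1) by (simp add: character_mult[OF \<phi>] character_power[OF \<phi>] power_in p(2)[OF \<phi>] y_def z_def)
      show "cmod (\<phi> (p * c' ^ (2 * N))) \<le> exp (R\<^sup>2) / t"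
      proof (cases "y \<le> 0")
        case True
        then show ?thesis using t by (simp add: val)
      next
        case False
        have "(cmod (z - \<i> * of_real t))\<^sup>2 = (cmod z)\<^sup>2 - 2 * t * y + t\<^sup>2"
          by (simp add: cmod_power2 y_def) (simp add: power2_eq_square algebra_simps)
        also have "\<dots> \<le> R\<^sup>2 - 2 * t * y + t\<^sup>2"
          using zR by (simp add: power_mono)
        finally have "(cmod (\<phi> c'))\<^sup>2 \<le> 1 + (R\<^sup>2 - 2 * t * y) / t\<^sup>2"
          using t by (simp add: c' norm_mult norm_divide power_mult_distrib power_divide divide_simps)
        also have "\<dots> \<le> exp ((R\<^sup>2 - 2 * t * y) / t\<^sup>2)"
          by (rule exp_ge_add_one_self)
        finally have "(cmod (\<phi> c')) ^ (2 * N) \<le> exp ((R\<^sup>2 - 2 * t * y) / t\<^sup>2) ^ N"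
          unfolding power_mult by (intro power_mono) auto
        also have "\<dots> = exp (R\<^sup>2 - 2 * t * y)"
          using t by (simp add: Nt flip: exp_of_nat_mult)
        also have "\<dots> = exp (R\<^sup>2) / exp (2 * t * y)" by (rule exp_diff)
        finally have le: "cmod (\<phi> c') ^ (2 * N) \<le> exp (R\<^sup>2) / exp (2 * t * y)" .
        have "cmod (\<phi> (p * c' ^ (2 * N))) = y * cmod (\<phi> c') ^ (2 * N)"
          using False by (simp add: val norm_mult norm_power)
        also have "\<dots> \<le> y * (exp (R\<^sup>2) / exp (2 * t * y))"
          using False by (intro mult_left_mono le) auto
        also have "\<dots> \<le> exp (R\<^sup>2) / t"
        proof -
          have "t * y \<le> 2 * t * y" using t False by simp
          also have "\<dots> \<le> exp (2 * t * y)" using exp_ge_add_one_self[of "2 * t * y"] by linarith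
          finally show ?thesis using t by (simp add: divide_simps mult_ac)
        qed
        finally show ?thesis .
      qed
    qed (use cD(1) p(1) t in \<open>simp_all add: mult_in power_in\<close>)
    ultimately show ?thesis
      using mult_right_mono[of "norm (p * c' ^ (2 * N))" "exp (R\<^sup>2) / t" "norm w"] by (simp add: t_def)
  qed
  have "norm (p * w) \<le> 0"
  proof (rule LIMSEQ_le_const)
    show "(\<lambda>m. exp (R\<^sup>2) * norm w / Suc m) \<longlonglongrightarrow> 0"
      by (rule LIMSEQ_Suc[OF lim_const_over_n])
  qed (use bound in blast)
  then show ?thesis by simp
qed

text \<open>
  The positive and negative parts \<open>p\<close> and \<open>q\<close> of the imaginary part of \<open>c\<close> annihilate \<open>w\<close>; for
  \<open>q\<close> this is the previous lemma for \<open>- c\<close> and \<open>- d\<close>.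
\<close>

lemma intertwined_sa:
  assumes d: "d \<in> sa" and c: "c \<in> D" and wd: "w * d = c * w"
  shows "c\<^sup>\<star> * w = c * w"
proof -
  have "continuous_on UNIV (\<lambda>z. max 0 (Im z))" by (intro continuous_intros)
  from real_functional_calculus[OF c this] obtain p where "p \<in> sa" and
    val_p: "\<And>\<phi>. \<phi> \<in> characters D \<Longrightarrow> \<phi> p = of_real (max 0 (Im (\<phi> c)))" by blast
  then have p: "p \<in> D" by (simp add: sa_def)
  have "continuous_on UNIV (\<lambda>z. max 0 (- Im z))" by (intro continuous_intros)
  from real_functional_calculus[OF c this] obtain q where "q \<in> sa" and
    val_q: "\<And>\<phi>. \<phi> \<in> characters D \<Longrightarrow> \<phi> q = of_real (max 0 (- Im (\<phi> c)))" by blast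
  then have q: "q \<in> D" by (simp add: sa_def)
  have pw: "p * w = 0" by (rule upper_half_plane_annihilates[OF d c wd p val_p])
  have "w * (- d) = (- c) * w" using wd by simp
  from upper_half_plane_annihilates[OF minus_sa[OF d] uminus_in[OF c] this q]
  have qw: "q * w = 0" using val_q c by (simp add: character_minus)
  have "c - c\<^sup>\<star> = (2 * \<i>) *\<^sub>C (p - q)"
  proof (rule characters_eqI)
    fix \<phi> assume \<phi>: "\<phi> \<in> characters D"
    show "\<phi> (c - c\<^sup>\<star>) = \<phi> ((2 * \<i>) *\<^sub>C (p - q))"
      using c p q val_p[OF \<phi>] val_q[OF \<phi>] by (auto simp: character_diff[OF \<phi>] character_star[OF \<phi>] character_scaleC[OF \<phi>] D_closed \<phi> complex_eq_iff max_def)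
  qed (use c p q in \<open>simp_all add: D_closed\<close>)
  then have "(c - c\<^sup>\<star>) * w = 0"
    using pw qw scaleC_diff_right[of "2 * \<i>" 0 "0::'a"] by (simp add: mult_scaleC_left left_diff_distrib)
  then show ?thesis by (simp add: left_diff_distrib)
qed

end

definition commutant :: "'a::unital_cstar_algebra set \<Rightarrow> 'a set" where
  "commutant S = {x. \<forall>y\<in>S. x * y = y * x}"

lemma star_subalgebra_commutant:
  assumes "\<And>x. x \<in> S \<Longrightarrow> x\<^sup>\<star> \<in> S"
  shows "star_subalgebra (commutant S)"
  unfolding star_subalgebra_def
proof (intro conjI ballI allI)
  fix x y assume xy: "x \<in> commutant S" "y \<in> commutant S"
  then show "x + y \<in> commutant S" by (simp add: commutant_def distrib_left distrib_right)
  show "x * y \<in> commutant S" using xy by (simp add: commutant_def) (metis mult.assoc)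
next
  fix x assume x: "x \<in> commutant S"
  then show "c *\<^sub>C x \<in> commutant S" for c 
    by (simp add: commutant_def mult_scaleC_left mult_scaleC_right)
  show "x\<^sup>\<star> \<in> commutant S"
    unfolding commutant_def
  proof (intro CollectI ballI)
    fix y assume "y \<in> S"
    then have "x * y\<^sup>\<star> = y\<^sup>\<star> * x" using x assms by (simp add: commutant_def)
    then show "x\<^sup>\<star> * y = y * x\<^sup>\<star>" by (metis star_mult star_star)
  qed
qed (simp add: commutant_def)

context abelian_cstar
begin

text \<open>
  The bicommutant of \<open>D\<close> together with \<open>h\<close> is an abelian star-subalgebra containing \<open>D\<close>, so by
  maximality it is \<open>D\<close>.
\<close>

lemma sa_in_masa:
  assumes masa: "masa D" and h: "h\<^sup>\<star> = h" "h \<in> commutant D"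
  shows "h \<in> D"
proof -
  define E where "E = insert h D"
  define A where "A = commutant (commutant E)"
  have starE: "x\<^sup>\<star> \<in> E" if "x \<in> E" for x using that h by (auto simp: E_def D_closed)
  have star_comm: "x\<^sup>\<star> \<in> commutant E" if "x \<in> commutant E" for x
    using star_subalgebra_commutant[of E] starE that by (simp add: star_subalgebra_def)
  have alg: "star_subalgebra A" unfolding A_def by (rule star_subalgebra_commutant) (rule star_comm)
  have "E \<subseteq> commutant E" using h by (auto simp: E_def commutant_def comm)
  then have "A \<subseteq> commutant E" unfolding A_def by (auto simp: commutant_def)
  have "abelian A"
    unfolding abelian_def
  proof (intro ballI)
    fix x y assume "x \<in> A" "y \<in> A"
    then have "x \<in> commutant (commutant E)" "y \<in> commutant E"
      using \<open>A \<subseteq> commutant E\<close> by (auto simp: A_def)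
    then show "x * y = y * x" unfolding commutant_def[of "commutant E"] by blast
  qed
  moreover have EA: "E \<subseteq> A" unfolding A_def by (auto simp: commutant_def)
  ultimately have "A = D" using masa alg unfolding masa_def E_def by blast
  then show ?thesis using EA by (auto simp: E_def)
qed

lemma commutant_masa:
  assumes masa: "masa D" and x: "x \<in> commutant D"
  shows "x \<in> D"
proof -
  have "star_subalgebra (commutant D)" by (rule star_subalgebra_commutant) (rule star_in)
  then have "re_part x \<in> commutant D" "im_part x \<in> commutant D"
    using x scaleC_minus_one[of "x\<^sup>\<star>"]
    by (auto simp: star_subalgebra_def re_part_def im_part_def scaleR_conv_scaleC)
       (metis (no_types, lifting) add_uminus_conv_diff)
  then have "re_part x \<in> D" "im_part x \<in> D" using sa_in_masa[OF masa] by auto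
  then show ?thesis by (subst re_im_decomp) (simp add: D_closed)
qed

lemma commutantI_sa:
  assumes "\<And>e. e \<in> sa \<Longrightarrow> x * e = e * x"
  shows "x \<in> commutant D"
  unfolding commutant_def
proof (intro CollectI ballI)
  fix y assume "y \<in> D"
  then have "x * re_part y = re_part y * x" "x * im_part y = im_part y * x"
    using assms re_part_sa im_part_sa by auto
  then show "x * y = y * x"
    by (subst (1 2) re_im_decomp[of y]) (simp add: distrib_left distrib_right mult_scaleC_left mult_scaleC_right)
qed

text \<open>
  By maximality it suffices to commute with self-adjoint \<open>e \<in> D\<close>. Writing \<open>e w = w f\<close> with \<open>f \<in> D\<close>,
  \<open>intertwined_sa\<close> turns the adjoint relation \<open>w\<^sup>\<star> e = f\<^sup>\<star> w\<^sup>\<star>\<close> into \<open>w\<^sup>\<star> e = f w\<^sup>\<star>\<close>, so \<open>e\<close>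
  can be carried from the right of \<open>w d w\<^sup>\<star>\<close> to its left. The case of \<open>w\<^sup>\<star> d w\<close> is similar.
\<close>

lemma intertwiner_normalizes_masa:
  assumes masa: "masa D" and w: "w \<in> intertwiners D"
  shows "w \<in> normalizers D"
proof -
  have swap: "(\<lambda>d. w * d) ` D = (\<lambda>d. d * w) ` D" using w by (simp add: intertwiners_def)
  have "w * d * w\<^sup>\<star> \<in> commutant D" if d: "d \<in> D" for d
  proof (rule commutantI_sa)
    fix e assume e: "e \<in> sa"
    then have "e * w \<in> (\<lambda>d. w * d) ` D" unfolding swap using sa_in_D by blast
    then obtain f where f: "f \<in> D" "e * w = w * f" by blast
    have "w\<^sup>\<star> * e = f\<^sup>\<star> * w\<^sup>\<star>" using f(2) sa_star[OF e] by (metis star_mult)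
    from intertwined_sa[OF e star_in[OF f(1)] this] have fw: "f * w\<^sup>\<star> = w\<^sup>\<star> * e" 
      using \<open>w\<^sup>\<star> * e = f\<^sup>\<star> * w\<^sup>\<star>\<close> by simp
    have "w * d * w\<^sup>\<star> * e = w * (d * f) * w\<^sup>\<star>" using fw by (simp add: mult.assoc)
    also have "\<dots> = (w * f) * d * w\<^sup>\<star>" using d f by (simp add: comm mult.assoc)
    also have "\<dots> = e * (w * d * w\<^sup>\<star>)" unfolding f(2)[symmetric] by (simp add: mult.assoc)
    finally show "w * d * w\<^sup>\<star> * e = e * (w * d * w\<^sup>\<star>)" .
  qed
  moreover have "w\<^sup>\<star> * d * w \<in> commutant D" if d: "d \<in> D" for d
  proof (rule commutantI_sa)
    fix e assume e: "e \<in> sa"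
    then have "w * e \<in> (\<lambda>d. d * w) ` D" unfolding swap[symmetric] using sa_in_D by blast
    then obtain f where f: "f \<in> D" "w * e = f * w" by blast
    have "f\<^sup>\<star> * w = w * e" using intertwined_sa[OF e f] f(2) by simp
    then have fw: "w\<^sup>\<star> * f = e * w\<^sup>\<star>" using sa_star[OF e] by (metis star_mult star_star)
    have "w\<^sup>\<star> * d * w * e = w\<^sup>\<star> * (d * f) * w" using f by (simp add: mult.assoc)
    also have "\<dots> = (w\<^sup>\<star> * f) * d * w" using d f by (simp add: comm mult.assoc)
    also have "\<dots> = e * (w\<^sup>\<star> * d * w)" unfolding fw by (simp add: mult.assoc)
    finally show "w\<^sup>\<star> * d * w * e = e * (w\<^sup>\<star> * d * w)" .
  qed
  ultimately show ?thesis
    using commutant_masa[OF masa] by (auto simp: normalizers_def)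
qed

lemma closed_normalizers: "closed (normalizers D)"
  unfolding closed_sequential_limits
proof (intro allI impI, elim conjE)
  fix x v assume x: "\<forall>n. x n \<in> normalizers D" and lim: "x \<longlonglongrightarrow> v"
  have "v * d * v\<^sup>\<star> \<in> D" "v\<^sup>\<star> * d * v \<in> D" if d: "d \<in> D" for d
  proof -
    have "(\<lambda>n. x n * d * (x n)\<^sup>\<star>) \<longlonglongrightarrow> v * d * v\<^sup>\<star>"
      by (intro tendsto_mult tendsto_star tendsto_const lim)
    then show "v * d * v\<^sup>\<star> \<in> D"
      by (rule closed_sequentially[OF closed_D, rotated]) (use x d normalizer_conj in simp)
    have "(\<lambda>n. (x n)\<^sup>\<star> * d * x n) \<longlonglongrightarrow> v\<^sup>\<star> * d * v"
      by (intro tendsto_mult tendsto_star tendsto_const lim)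
    then show "v\<^sup>\<star> * d * v \<in> D"
      by (rule closed_sequentially[OF closed_D, rotated]) (use x d normalizer_star_conj in simp)
  qed
  then show "v \<in> normalizers D" by (auto simp: normalizers_def)
qed

end

theorem proposition3p3:
  fixes D :: "'a::unital_cstar_algebra set"
  assumes "cstar_subalgebra D" and "abelian D" and "1 \<in> D"
  shows "(\<forall>v\<in>normalizers D. beta_extends D (v\<^sup>\<star>) \<longrightarrow> (\<lambda>d. v * d) ` D = (\<lambda>d. d * v) ` D) \<and>
         normalizers D \<subseteq> closure (intertwiners D) \<and>
         (masa D \<longrightarrow> normalizers D = closure (intertwiners D))"
proof -
  interpret abelian_cstar D using assms by unfold_locales
  have "closure (intertwiners D) \<subseteq> normalizers D" if "masa D"
    using intertwiner_normalizes_masa[OF that] closed_normalizers by (intro closure_minimal) auto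
  then show ?thesis
    using intertwiner_of_extension normalizers_subset_closure by blast
qed

end
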